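(* Let $G=N\rtimes H$, $M$, $\mathcal U$, $D$, $D_0$, $\alpha$ and $D_0\rtimes_\alpha G$ be as in the context, with $\mathcal U$ having finite quotients and $H$ acting effectively on $M$. For every covariant representation $(\pi,u)$ of $(D_0,G)$ on a Hilbert space $X$, there is a unique representation $\Pi$ of $D_0\rtimes_\alpha G$ on $X$ such that $$\Pi(gf)=u_g\pi(f)\quad\text{for } g\in G,\ f\in D_0.$$
   Context: $G=N\rtimes H$ is a discrete group which is a semidirect product with normal subgroup $N$ and quotient group $H$ (regarded as a subgroup of $G$, acting on $N$ by conjugation), and $M\neq\{e\}$ is a normal subgroup of $N$. Put $\mathcal U=\{aMa^{-1}:a\in H\}$. Standing assumptions: (filter base) for all $U,V\in\mathcal U$ there is $W\in\mathcal U$ with $W\subseteq U\cap V$; (separating) $\bigcap_{U\in\mathcal U}U=\{e\}$; (finite quotients) $|U/V|<\infty$ whenever $V\subseteq U$ in $\mathcal U$; (effective) for each $a\ne e$ in $H$ there is $s\in M$ with $asa^{-1}\neq s$. For $g=xa\in G$ with $x\in N$, $a\in H$, let $\beta_g:N\to N$, $\beta_g(y)=xaya^{-1}$, and let $\alpha_g(f)=f\circ\beta_{g^{-1}}$ for $f\in\ell^\infty(N)$. Let $\mathcal P=\{\chi_{xU}:x\in N,U\in\mathcal U\}\subseteq\ell^\infty(N)$, let $D=C^*(\mathcal P)\subseteq\ell^\infty(N)$, and let $D_0=\operatorname{span}\mathcal P$, a dense $\alpha$-invariant $*$-subalgebra of $D$. $\alpha$ restricts to an action of $G$ on $D$. $D\rtimes_\alpha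 G$ is the full $C^*$-crossed product, with canonical maps $i_D:D\to M(D\rtimes_\alpha G)$ and $i_G:G\to UM(D\rtimes_\alpha G)$, which are suppressed from the notation (elements of $D_0$ and $G$ are identified with their images). The algebraic crossed product is the $*$-subalgebra $D_0\rtimes_\alpha G:=\operatorname{span} i_G(G)i_D(D_0)$ of $D\rtimes_\alpha G$. A representation of a $*$-algebra $B$ on a Hilbert space $X$ is a $*$-homomorphism $B\to\mathcal B(X)$ (not assumed nondegenerate). If $\pi$ is a representation of $D_0$ and $u$ a unitary representation of $G$ on $X$, then $(\pi,u)$ is a covariant representation of $(D_0,G)$ if $u_g\pi(f)u_g^*=\pi(\alpha_g(f))$ for all $g\in G$, $f\in D_0$. *)

theory Defs
  imports "HOL-Analysis.Analysis" "HOL-Algebra.Coset"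
begin

section \<open>Complex Hilbert spaces\<close>

text \<open>
  The inner product \<open>cinner\<close> is linear in its first argument.  The underlying real
  inner product of \<^class>\<open>real_inner\<close> is its real part, so the norm is the usual one.
\<close>

class complex_inner = real_inner +
  fixes scaleC :: "complex \<Rightarrow> 'a \<Rightarrow> 'a" (infixr \<open>*\<^sub>C\<close> 75)
    and cinner :: "'a \<Rightarrow> 'a \<Rightarrow> complex"
  assumes scaleC_add_right: "c *\<^sub>C (x + y) = c *\<^sub>C x + c *\<^sub>C y"
    and scaleC_add_left: "(c + d) *\<^sub>C x = c *\<^sub>C x + d *\<^sub>C x"
    and scaleC_scaleC: "c *\<^sub>C d *\<^sub>C x = (c * d) *\<^sub>C x"
    and scaleC_of_real: "complex_of_real r *\<^sub>C x = r *\<^sub>R x"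
    and cinner_commute: "cinner x y = cnj (cinner y x)"
    and cinner_add_left: "cinner (x + y) z = cinner x z + cinner y z"
    and cinner_scaleC_left: "cinner (c *\<^sub>C x) y = c * cinner x y"
    and inner_eq_Re_cinner: "inner x y = Re (cinner x y)"

class complex_hilbert = complex_inner + complete_space

typedef 'i ell2 = "{f :: 'i \<Rightarrow> complex. (\<lambda>i. (cmod (f i))\<^sup>2) summable_on UNIV}"
  morphisms ell2_coord Abs_ell2
  by (rule exI[of _ "\<lambda>_. 0"]) simp

setup_lifting type_definition_ell2

lemma ell2_coord_summable: "(\<lambda>i. (cmod (ell2_coord x i))\<^sup>2) summable_on UNIV"
  using ell2_coord[of x] by simp

lemma cmod_sum_sq_le: "(cmod (a + b))\<^sup>2 \<le> 2 * (cmod a)\<^sup>2 + 2 * (cmod b)\<^sup>2"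
proof -
  have "(cmod (a + b))\<^sup>2 \<le> (cmod a + cmod b)\<^sup>2"
    by (simp add: norm_triangle_ineq power_mono)
  also have "\<dots> \<le> 2 * (cmod a)\<^sup>2 + 2 * (cmod b)\<^sup>2"
    using sum_squares_bound[of "cmod a" "cmod b"] by (simp add: power2_sum)
  finally show ?thesis .
qed

lemma ell2_add_summable:
  assumes "(\<lambda>i. (cmod (f i))\<^sup>2) summable_on UNIV" "(\<lambda>i. (cmod (g i))\<^sup>2) summable_on UNIV"
  shows "(\<lambda>i. (cmod (f i + g i))\<^sup>2) summable_on UNIV"
proof (rule summable_on_comparison_test)
  show "(\<lambda>i. 2 * (cmod (f i))\<^sup>2 + 2 * (cmod (g i))\<^sup>2) summable_on UNIV"
    using assms by (intro summable_on_add summable_on_cmult_right)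
qed (simp_all add: cmod_sum_sq_le)

lemma ell2_scale_summable:
  assumes "(\<lambda>i. (cmod (f i))\<^sup>2) summable_on UNIV"
  shows "(\<lambda>i. (cmod (c * f i))\<^sup>2) summable_on UNIV"
  using summable_on_cmult_right[OF assms, of "(cmod c)\<^sup>2"]
  by (simp add: norm_mult power_mult_distrib)

lemma ell2_inner_summable:
  assumes "(\<lambda>i. (cmod (f i))\<^sup>2) summable_on UNIV" "(\<lambda>i. (cmod (g i))\<^sup>2) summable_on UNIV"
  shows "(\<lambda>i. f i * cnj (g i)) summable_on UNIV"
proof (rule abs_summable_summable, rule summable_on_comparison_test)
  show "(\<lambda>i. (cmod (f i))\<^sup>2 + (cmod (g i))\<^sup>2) summable_on UNIV"
    using assms by (intro summable_on_add)
  fix i :: 'a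
  have "2 * cmod (f i) * cmod (g i) \<le> (cmod (f i))\<^sup>2 + (cmod (g i))\<^sup>2"
    by (rule sum_squares_bound)
  moreover have "0 \<le> cmod (f i) * cmod (g i)" by simp
  ultimately show "norm (f i * cnj (g i)) \<le> (cmod (f i))\<^sup>2 + (cmod (g i))\<^sup>2"
    unfolding norm_mult complex_mod_cnj by linarith
qed simp

lemma Re_infsum_mult_cnj:
  assumes "(\<lambda>i. (cmod (f i))\<^sup>2) summable_on UNIV"
  shows "Re (\<Sum>\<^sub>\<infinity>i. f i * cnj (f i)) = (\<Sum>\<^sub>\<infinity>i. (cmod (f i))\<^sup>2)"
proof -
  have "Re (\<Sum>\<^sub>\<infinity>i. f i * cnj (f i)) = (\<Sum>\<^sub>\<infinity>i. Re (f i * cnj (f i)))"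
    by (rule infsum_Re[symmetric, OF ell2_inner_summable[OF assms assms]])
  also have "\<dots> = (\<Sum>\<^sub>\<infinity>i. (cmod (f i))\<^sup>2)"
    by (rule infsum_cong) (simp flip: power2_eq_square add: cmod_power2)
  finally show ?thesis .
qed

instantiation ell2 :: (type) complex_inner
begin

lift_definition zero_ell2 :: "'a ell2" is "\<lambda>_. 0" by simp

lift_definition plus_ell2 :: "'a ell2 \<Rightarrow> 'a ell2 \<Rightarrow> 'a ell2" is "\<lambda>f g i. f i + g i"
  by (rule ell2_add_summable)

lift_definition uminus_ell2 :: "'a ell2 \<Rightarrow> 'a ell2" is "\<lambda>f i. - f i" by simp

lift_definition minus_ell2 :: "'a ell2 \<Rightarrow> 'a ell2 \<Rightarrow> 'a ell2" is "\<lambda>f g i. f i - g i"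
  using ell2_add_summable[of _ "\<lambda>i. - _ i"] by simp

lift_definition scaleC_ell2 :: "complex \<Rightarrow> 'a ell2 \<Rightarrow> 'a ell2" is "\<lambda>c f i. c * f i"
  by (rule ell2_scale_summable)

lift_definition scaleR_ell2 :: "real \<Rightarrow> 'a ell2 \<Rightarrow> 'a ell2" is "\<lambda>r f i. complex_of_real r * f i"
  by (rule ell2_scale_summable)

lift_definition cinner_ell2 :: "'a ell2 \<Rightarrow> 'a ell2 \<Rightarrow> complex"
  is "\<lambda>f g. \<Sum>\<^sub>\<infinity>i. f i * cnj (g i)" .

definition inner_ell2 :: "'a ell2 \<Rightarrow> 'a ell2 \<Rightarrow> real"
  where "inner_ell2 x y = Re (cinner x y)"

definition norm_ell2 :: "'a ell2 \<Rightarrow> real"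
  where "norm_ell2 x = sqrt (inner x x)"

definition sgn_ell2 :: "'a ell2 \<Rightarrow> 'a ell2"
  where "sgn_ell2 x = inverse (norm x) *\<^sub>R x"

definition dist_ell2 :: "'a ell2 \<Rightarrow> 'a ell2 \<Rightarrow> real"
  where "dist_ell2 x y = norm (x - y)"

definition [code del]:
  "(uniformity :: ('a ell2 \<times> 'a ell2) filter) = (INF e\<in>{0<..}. principal {(x, y). dist x y < e})"

definition [code del]:
  "open (U :: 'a ell2 set) \<longleftrightarrow> (\<forall>x\<in>U. \<forall>\<^sub>F (x', y) in uniformity. x' = x \<longrightarrow> y \<in> U)"

instance
proof
  fix x y z :: "'a ell2" and c d :: complex and r s :: real
  show "x + y + z = x + (y + z)" "x + y = y + x" "0 + x = x" "- x + x = 0" "x - y = x + - y"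
    by (transfer; simp add: algebra_simps)+
  show "r *\<^sub>R (x + y) = r *\<^sub>R x + r *\<^sub>R y" "(r + s) *\<^sub>R x = r *\<^sub>R x + s *\<^sub>R x"
    "r *\<^sub>R s *\<^sub>R x = (r * s) *\<^sub>R x" "1 *\<^sub>R x = x"
    by (transfer; simp add: algebra_simps)+
  show "c *\<^sub>C (x + y) = c *\<^sub>C x + c *\<^sub>C y" "(c + d) *\<^sub>C x = c *\<^sub>C x + d *\<^sub>C x"
    "c *\<^sub>C d *\<^sub>C x = (c * d) *\<^sub>C x" "complex_of_real r *\<^sub>C x = r *\<^sub>R x"
    by (transfer; simp add: algebra_simps)+
  show comm: "cinner x y = cnj (cinner y x)"
    by transfer (subst infsum_cnj[symmetric], simp del: infsum_cnj add: mult.commute)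
  show add: "cinner (x + y) z = cinner x z + cinner y z"
    by transfer (simp add: distrib_right infsum_add ell2_inner_summable)
  have scale: "cinner (c *\<^sub>C x) y = c * cinner x y" for c and x y :: "'a ell2"
    by transfer (simp add: mult.assoc infsum_cmult_right')
  show "cinner (c *\<^sub>C x) y = c * cinner x y" by (rule scale)
  show "inner x y = Re (cinner x y)" by (rule inner_ell2_def)
  show "inner x y = inner y x" unfolding inner_ell2_def by (subst comm) simp
  show "inner (x + y) z = inner x z + inner y z" by (simp add: inner_ell2_def add)
  have "r *\<^sub>R x = complex_of_real r *\<^sub>C x" by transfer simp
  then show "inner (r *\<^sub>R x) y = r * inner x y" by (simp add: inner_ell2_def scale)
  have self: "inner x x = (\<Sum>\<^sub>\<infinity>i. (cmod (ell2_coord x i))\<^sup>2)"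
    for x :: "'a ell2"
    unfolding inner_ell2_def cinner_ell2.rep_eq
    by (rule Re_infsum_mult_cnj[OF ell2_coord_summable])
  show "0 \<le> inner x x" unfolding self by (simp add: infsum_nonneg)
  show "inner x x = 0 \<longleftrightarrow> x = 0"
  proof
    assume "inner x x = 0"
    then have "(cmod (ell2_coord x i))\<^sup>2 = 0" for i
      unfolding self
      by (intro nonneg_infsum_le_0D[OF _ ell2_coord_summable[of x]]) simp_all
    then have "ell2_coord x = ell2_coord 0" by (auto simp: zero_ell2.rep_eq)
    then show "x = 0" by (simp add: ell2_coord_inject)
  qed (simp add: self zero_ell2.rep_eq)
qed (simp_all add: norm_ell2_def sgn_ell2_def dist_ell2_def uniformity_ell2_def open_ell2_def)

end

lemma norm_ell2_sq: "(norm x)\<^sup>2 = (\<Sum>\<^sub>\<infinity>i. (cmod (ell2_coord x i))\<^sup>2)"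
proof -
  have "(norm x)\<^sup>2 = Re (cinner x x)"
    by (simp add: power2_norm_eq_inner inner_eq_Re_cinner)
  also have "\<dots> = (\<Sum>\<^sub>\<infinity>i. (cmod (ell2_coord x i))\<^sup>2)"
    unfolding cinner_ell2.rep_eq by (rule Re_infsum_mult_cnj[OF ell2_coord_summable])
  finally show ?thesis .
qed

lemma ell2_sum_le_norm:
  assumes "finite F"
  shows "(\<Sum>i\<in>F. (cmod (ell2_coord x i))\<^sup>2) \<le> (norm x)\<^sup>2"
  unfolding norm_ell2_sq using ell2_coord_summable assms by (intro finite_sum_le_infsum) auto

lemma ell2_coord_le_norm: "cmod (ell2_coord x i) \<le> norm x"
  by (rule power2_le_imp_le) (use ell2_sum_le_norm[of "{i}" x] in simp_all)

instance ell2 :: (type) complex_hilbert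
proof
  fix X :: "nat \<Rightarrow> 'a ell2"
  assume X: "Cauchy X"
  have coord: "Cauchy (\<lambda>n. ell2_coord (X n) i)" for i
  proof (rule CauchyI)
    fix e :: real assume "0 < e"
    then obtain K where K: "\<forall>m\<ge>K. \<forall>n\<ge>K. norm (X m - X n) < e" using X CauchyD by blast
    have "cmod (ell2_coord (X m) i - ell2_coord (X n) i) \<le> norm (X m - X n)" for m n
      using ell2_coord_le_norm[of "X m - X n" i] by (simp add: minus_ell2.rep_eq)
    then show "\<exists>K. \<forall>m\<ge>K. \<forall>n\<ge>K. cmod (ell2_coord (X m) i - ell2_coord (X n) i) < e"
      using K by (meson order_le_less_trans)
  qed
  define f where "f i = lim (\<lambda>n. ell2_coord (X n) i)" for i
  have f: "(\<lambda>n. ell2_coord (X n) i) \<longlonglongrightarrow> f i" for i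
    using coord[of i] by (simp add: Cauchy_convergent_iff convergent_LIMSEQ_iff f_def)
  have fin: "(\<Sum>i\<in>F. (cmod (ell2_coord (X m) i - f i))\<^sup>2) \<le> e\<^sup>2"
    if "finite F" and K: "\<forall>m\<ge>K. \<forall>n\<ge>K. norm (X m - X n) < e" and "m \<ge> K" for F K e m
  proof (rule tendsto_upperbound)
    show "(\<lambda>n. \<Sum>i\<in>F. (cmod (ell2_coord (X m) i - ell2_coord (X n) i))\<^sup>2)
      \<longlonglongrightarrow> (\<Sum>i\<in>F. (cmod (ell2_coord (X m) i - f i))\<^sup>2)"
      by (intro tendsto_intros f)
    show "\<forall>\<^sub>F n in sequentially. (\<Sum>i\<in>F. (cmod (ell2_coord (X m) i - ell2_coord (X n) i))\<^sup>2) \<le> e\<^sup>2"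
    proof (rule eventually_sequentiallyI[of K])
      fix n assume "K \<le> n"
      have "(\<Sum>i\<in>F. (cmod (ell2_coord (X m) i - ell2_coord (X n) i))\<^sup>2) \<le> (norm (X m - X n))\<^sup>2"
        using ell2_sum_le_norm[OF \<open>finite F\<close>, of "X m - X n"] by (simp add: minus_ell2.rep_eq)
      also have "\<dots> \<le> e\<^sup>2"
        using K \<open>m \<ge> K\<close> \<open>K \<le> n\<close> by (intro power_mono) (auto simp: less_imp_le)
      finally show "(\<Sum>i\<in>F. (cmod (ell2_coord (X m) i - ell2_coord (X n) i))\<^sup>2) \<le> e\<^sup>2" .
    qed
  qed simp
  have summ: "(\<lambda>i. (cmod (ell2_coord (X m) i - f i))\<^sup>2) summable_on UNIV"
    if "\<forall>m\<ge>K. \<forall>n\<ge>K. norm (X m - X n) < e" "m \<ge> K" for K e m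
    using fin that by (intro nonneg_bdd_above_summable_on bdd_aboveI2[of _ _ "e\<^sup>2"]) auto
  obtain K1 where K1: "\<forall>m\<ge>K1. \<forall>n\<ge>K1. norm (X m - X n) < 1"
    using X CauchyD[of X 1] by auto
  have "(\<lambda>i. (cmod (ell2_coord (X K1) i + (- 1) * (ell2_coord (X K1) i - f i)))\<^sup>2) summable_on UNIV"
    by (rule ell2_add_summable[OF ell2_coord_summable ell2_scale_summable[OF summ[OF K1]]]) simp
  then have "(\<lambda>i. (cmod (f i))\<^sup>2) summable_on UNIV" by simp
  then have Lc: "ell2_coord (Abs_ell2 f) = f" by (simp add: Abs_ell2_inverse)
  have "X \<longlonglongrightarrow> Abs_ell2 f"
  proof (rule LIMSEQ_I)
    fix e :: real assume "0 < e"
    then obtain K where K: "\<forall>m\<ge>K. \<forall>n\<ge>K. norm (X m - X n) < e / 2"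
      using X CauchyD[of X "e / 2"] by auto
    have "norm (X m - Abs_ell2 f) < e" if "m \<ge> K" for m
    proof -
      have "(norm (X m - Abs_ell2 f))\<^sup>2 = (\<Sum>\<^sub>\<infinity>i. (cmod (ell2_coord (X m) i - f i))\<^sup>2)"
        by (simp add: norm_ell2_sq minus_ell2.rep_eq Lc)
      also have "\<dots> \<le> (e / 2)\<^sup>2"
        by (rule infsum_le_finite_sums[OF summ[OF K that]]) (rule fin[OF _ K that])
      finally have "norm (X m - Abs_ell2 f) \<le> e / 2"
        by (rule power2_le_imp_le) (use \<open>0 < e\<close> in simp)
      with \<open>0 < e\<close> show ?thesis by simp
    qed
    then show "\<exists>K. \<forall>m\<ge>K. norm (X m - Abs_ell2 f) < e" by blast
  qed
  then show "convergent X" by (auto simp: convergent_def)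
qed


section \<open>Operators and representations of \<open>*\<close>-algebras\<close>

definition bounded_clinear :: "('x::complex_inner \<Rightarrow> 'x) \<Rightarrow> bool"
  where "bounded_clinear T \<longleftrightarrow> bounded_linear T \<and> (\<forall>c x. T (c *\<^sub>C x) = c *\<^sub>C T x)"

definition is_adjoint :: "('x::complex_inner \<Rightarrow> 'x) \<Rightarrow> ('x \<Rightarrow> 'x) \<Rightarrow> bool"
  where "is_adjoint T S \<longleftrightarrow> (\<forall>x y. cinner (T x) y = cinner x (S y))"

text \<open>On a Hilbert space every bounded operator has exactly one adjoint.\<close>

definition cadjoint :: "('x::complex_inner \<Rightarrow> 'x) \<Rightarrow> 'x \<Rightarrow> 'x"
  where "cadjoint T = (THE S. is_adjoint T S)"

definition unitary_op :: "('x::complex_inner \<Rightarrow> 'x) \<Rightarrow> bool"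
  where "unitary_op T \<longleftrightarrow> bounded_clinear T \<and> surj T \<and> (\<forall>x y. cinner (T x) (T y) = cinner x y)"

record 'b star_algebra = "'b partial_object" +
  azero :: 'b
  aadd :: "'b \<Rightarrow> 'b \<Rightarrow> 'b"
  ascale :: "complex \<Rightarrow> 'b \<Rightarrow> 'b"
  amult :: "'b \<Rightarrow> 'b \<Rightarrow> 'b"
  astar :: "'b \<Rightarrow> 'b"

inductive_set alg_span :: "('b, 'm) star_algebra_scheme \<Rightarrow> 'b set \<Rightarrow> 'b set"
  for B :: "('b, 'm) star_algebra_scheme" and S :: "'b set"
  where
    zero: "azero B \<in> alg_span B S"
  | base: "s \<in> S \<Longrightarrow> s \<in> alg_span B S"
  | add: "a \<in> alg_span B S \<Longrightarrow> b \<in> alg_span B S \<Longrightarrow> aadd B a b \<in> alg_span B S"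
  | scale: "a \<in> alg_span B S \<Longrightarrow> ascale B c a \<in> alg_span B S"

definition representation ::
    "('b, 'm) star_algebra_scheme \<Rightarrow> ('b \<Rightarrow> 'x::complex_hilbert \<Rightarrow> 'x) \<Rightarrow> bool"
  where "representation B \<pi> \<longleftrightarrow>
    (\<forall>a\<in>carrier B. bounded_clinear (\<pi> a)) \<and>
    (\<forall>a\<in>carrier B. \<forall>b\<in>carrier B. \<pi> (aadd B a b) = (\<lambda>\<xi>. \<pi> a \<xi> + \<pi> b \<xi>)) \<and>
    (\<forall>c. \<forall>a\<in>carrier B. \<pi> (ascale B c a) = (\<lambda>\<xi>. c *\<^sub>C \<pi> a \<xi>)) \<and>
    (\<forall>a\<in>carrier B. \<forall>b\<in>carrier B. \<pi> (amult B a b) = \<pi> a \<circ> \<pi> b) \<and>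
    (\<forall>a\<in>carrier B. is_adjoint (\<pi> a) (\<pi> (astar B a)))"

definition unitary_representation ::
    "('g, 'm) monoid_scheme \<Rightarrow> ('g \<Rightarrow> 'x::complex_hilbert \<Rightarrow> 'x) \<Rightarrow> bool"
  where "unitary_representation G u \<longleftrightarrow>
    (\<forall>g\<in>carrier G. unitary_op (u g)) \<and>
    (\<forall>g\<in>carrier G. \<forall>h\<in>carrier G. u (g \<otimes>\<^bsub>G\<^esub> h) = u g \<circ> u h)"


section \<open>The group data\<close>

definition semidirect_product :: "('g, 'm) monoid_scheme \<Rightarrow> 'g set \<Rightarrow> 'g set \<Rightarrow> bool"
  where "semidirect_product G N H \<longleftrightarrow>
    group G \<and> N \<lhd> G \<and> subgroup H G \<and> N \<inter> H = {\<one>\<^bsub>G\<^esub>} \<and> N <#>\<^bsub>G\<^esub> H = carrier G"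

definition conjugates :: "('g, 'm) monoid_scheme \<Rightarrow> 'g set \<Rightarrow> 'g set \<Rightarrow> 'g set set"
  where "conjugates G H M = {(a <#\<^bsub>G\<^esub> M) #>\<^bsub>G\<^esub> inv\<^bsub>G\<^esub> a | a. a \<in> H}"

definition is_filter_base :: "'g set set \<Rightarrow> bool"
  where "is_filter_base \<U> \<longleftrightarrow> (\<forall>U\<in>\<U>. \<forall>V\<in>\<U>. \<exists>W\<in>\<U>. W \<subseteq> U \<inter> V)"

definition separating :: "('g, 'm) monoid_scheme \<Rightarrow> 'g set set \<Rightarrow> bool"
  where "separating G \<U> \<longleftrightarrow> \<Inter>\<U> = {\<one>\<^bsub>G\<^esub>}"

definition has_finite_quotients :: "('g, 'm) monoid_scheme \<Rightarrow> 'g set set \<Rightarrow> bool"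
  where "has_finite_quotients G \<U> \<longleftrightarrow>
    (\<forall>U\<in>\<U>. \<forall>V\<in>\<U>. V \<subseteq> U \<longrightarrow> finite (carrier (G\<lparr>carrier := U\<rparr> Mod V)))"

definition acts_effectively :: "('g, 'm) monoid_scheme \<Rightarrow> 'g set \<Rightarrow> 'g set \<Rightarrow> bool"
  where "acts_effectively G H M \<longleftrightarrow>
    (\<forall>a\<in>H. a \<noteq> \<one>\<^bsub>G\<^esub> \<longrightarrow> (\<exists>s\<in>M. a \<otimes>\<^bsub>G\<^esub> s \<otimes>\<^bsub>G\<^esub> inv\<^bsub>G\<^esub> a \<noteq> s))"


section \<open>The action on bounded functions\<close>

text \<open>
  Functions on \<open>N\<close> are represented by their extension by zero to the whole type.
\<close>

definition linf :: "'g set \<Rightarrow> ('g \<Rightarrow> complex) star_algebra"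
  where "linf N =
    \<lparr>carrier = {f. (\<forall>y. y \<notin> N \<longrightarrow> f y = 0) \<and> bounded (range f)},
     azero = (\<lambda>_. 0),
     aadd = (\<lambda>f h y. f y + h y),
     ascale = (\<lambda>c f y. c * f y),
     amult = (\<lambda>f h y. f y * h y),
     astar = (\<lambda>f y. cnj (f y))\<rparr>"

text \<open>The components of \<open>g = x a\<close> with \<open>x \<in> N\<close> and \<open>a \<in> H\<close>.\<close>

definition npart :: "('g, 'm) monoid_scheme \<Rightarrow> 'g set \<Rightarrow> 'g set \<Rightarrow> 'g \<Rightarrow> 'g"
  where "npart G N H g = (THE x. x \<in> N \<and> (\<exists>a\<in>H. g = x \<otimes>\<^bsub>G\<^esub> a))"

definition hpart :: "('g, 'm) monoid_scheme \<Rightarrow> 'g set \<Rightarrow> 'g set \<Rightarrow> 'g \<Rightarrow> 'g"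
  where "hpart G N H g = (THE a. a \<in> H \<and> (\<exists>x\<in>N. g = x \<otimes>\<^bsub>G\<^esub> a))"

definition beta :: "('g, 'm) monoid_scheme \<Rightarrow> 'g set \<Rightarrow> 'g set \<Rightarrow> 'g \<Rightarrow> 'g \<Rightarrow> 'g"
  where "beta G N H g y =
    npart G N H g \<otimes>\<^bsub>G\<^esub> hpart G N H g \<otimes>\<^bsub>G\<^esub> y \<otimes>\<^bsub>G\<^esub> inv\<^bsub>G\<^esub> (hpart G N H g)"

definition alpha ::
    "('g, 'm) monoid_scheme \<Rightarrow> 'g set \<Rightarrow> 'g set \<Rightarrow> 'g \<Rightarrow> ('g \<Rightarrow> complex) \<Rightarrow> 'g \<Rightarrow> complex"
  where "alpha G N H g f = (\<lambda>y. if y \<in> N then f (beta G N H (inv\<^bsub>G\<^esub> g) y) else 0)"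

definition coset_funs ::
    "('g, 'm) monoid_scheme \<Rightarrow> 'g set \<Rightarrow> 'g set \<Rightarrow> 'g set \<Rightarrow> ('g \<Rightarrow> complex) set"
  where "coset_funs G N H M =
    {indicator (x <#\<^bsub>G\<^esub> U) | x U. x \<in> N \<and> U \<in> conjugates G H M}"

definition linf_closed_star_subalgebra :: "'g set \<Rightarrow> ('g \<Rightarrow> complex) set \<Rightarrow> bool"
  where "linf_closed_star_subalgebra N B \<longleftrightarrow>
    B \<subseteq> carrier (linf N) \<and> azero (linf N) \<in> B \<and>
    (\<forall>f\<in>B. \<forall>h\<in>B. aadd (linf N) f h \<in> B \<and> amult (linf N) f h \<in> B) \<and>
    (\<forall>f\<in>B. (\<forall>c. ascale (linf N) c f \<in> B) \<and> astar (linf N) f \<in> B) \<and>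
    (\<forall>f\<in>carrier (linf N). (\<forall>\<epsilon>>0. \<exists>h\<in>B. \<forall>y\<in>N. cmod (f y - h y) \<le> \<epsilon>) \<longrightarrow> f \<in> B)"

definition D_alg ::
    "('g, 'm) monoid_scheme \<Rightarrow> 'g set \<Rightarrow> 'g set \<Rightarrow> 'g set \<Rightarrow> ('g \<Rightarrow> complex) star_algebra"
  where "D_alg G N H M = (linf N)
    \<lparr>carrier := \<Inter>{B. coset_funs G N H M \<subseteq> B \<and> linf_closed_star_subalgebra N B}\<rparr>"

definition D0_alg ::
    "('g, 'm) monoid_scheme \<Rightarrow> 'g set \<Rightarrow> 'g set \<Rightarrow> 'g set \<Rightarrow> ('g \<Rightarrow> complex) star_algebra"
  where "D0_alg G N H M = (linf N)\<lparr>carrier := alg_span (linf N) (coset_funs G N H M)\<rparr>"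

text \<open>
  Covariant representations of \<open>(B, G)\<close> for an \<open>\<alpha>\<close>-invariant algebra \<open>B\<close> of functions on \<open>N\<close>.
  As for representations, no nondegeneracy is required.
\<close>

definition covariant_representation ::
    "('g, 'm) monoid_scheme \<Rightarrow> 'g set \<Rightarrow> 'g set \<Rightarrow> ('g \<Rightarrow> complex) star_algebra \<Rightarrow>
     (('g \<Rightarrow> complex) \<Rightarrow> 'x \<Rightarrow> 'x) \<Rightarrow> ('g \<Rightarrow> 'x \<Rightarrow> 'x::complex_hilbert) \<Rightarrow> bool"
  where "covariant_representation G N H B \<pi> u \<longleftrightarrow>
    representation B \<pi> \<and> unitary_representation G u \<and>
    (\<forall>g\<in>carrier G. \<forall>f\<in>carrier B. u g \<circ> \<pi> f \<circ> cadjoint (u g) = \<pi> (alpha G N H g f))"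


section \<open>The full crossed product\<close>

text \<open>
  The full crossed product is the completion of the compactly (here: finitely) supported functions
  \<open>G \<rightarrow> D\<close> in the universal norm, the supremum of \<open>\<parallel>(\<pi> \<rtimes> u)(F)\<parallel>\<close> over all covariant
  representations \<open>(\<pi>, u)\<close> of \<open>(D, G)\<close>.  It is realised in the product of all
  covariant representations on \<open>\<ell>\<^sup>2(G \<times> \<nat>)\<close>: an element is a family of operators indexed by
  covariant representations, and the norm is the supremum of the operator norms.

  Using this one Hilbert space loses nothing.  \<open>D\<close> is generated by at most \<open>\<bar>G \<times> G\<bar>\<close>
  projections, so a cyclic subspace for a covariant representation on any Hilbert space has
  Hilbert dimension at most \<open>\<bar>G \<times> \<nat>\<bar>\<close>; it embeds isometrically in \<open>\<ell>\<^sup>2(G \<times> \<nat>)\<close>, and one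
  extends by \<open>\<pi> = 0\<close>, \<open>u = 1\<close> on the orthogonal complement.  Hence the supremum is the
  universal norm.
\<close>

type_synonym 'g univ_space = "('g \<times> nat) ell2"

type_synonym 'g univ_index =
  "(('g \<Rightarrow> complex) \<Rightarrow> 'g univ_space \<Rightarrow> 'g univ_space) \<times> ('g \<Rightarrow> 'g univ_space \<Rightarrow> 'g univ_space)"

type_synonym 'g univ_family = "'g univ_index \<Rightarrow> 'g univ_space \<Rightarrow> 'g univ_space"

definition cov_reps ::
    "('g, 'm) monoid_scheme \<Rightarrow> 'g set \<Rightarrow> 'g set \<Rightarrow> 'g set \<Rightarrow> 'g univ_index set"
  where "cov_reps G N H M = {(\<pi>, u). covariant_representation G N H (D_alg G N H M) \<pi> u}"

definition fin_supp_funs ::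
    "('g, 'm) monoid_scheme \<Rightarrow> ('g \<Rightarrow> complex) star_algebra \<Rightarrow> ('g \<Rightarrow> 'g \<Rightarrow> complex) set"
  where "fin_supp_funs G B =
    {F. (\<forall>g\<in>carrier G. F g \<in> carrier B) \<and> finite {g \<in> carrier G. F g \<noteq> azero B}}"

text \<open>The integrated form \<open>(\<pi> \<rtimes> u)(F) = \<Sum>\<^sub>g \<pi>(F(g)) u\<^sub>g\<close>.\<close>

definition integrated_form ::
    "('g, 'm) monoid_scheme \<Rightarrow> ('g \<Rightarrow> complex) star_algebra \<Rightarrow>
     (('g \<Rightarrow> complex) \<Rightarrow> 'x \<Rightarrow> 'x) \<Rightarrow> ('g \<Rightarrow> 'x \<Rightarrow> 'x::complex_hilbert) \<Rightarrow>
     ('g \<Rightarrow> 'g \<Rightarrow> complex) \<Rightarrow> 'x \<Rightarrow> 'x"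
  where "integrated_form G B \<pi> u F \<xi> = (\<Sum>g | g \<in> carrier G \<and> F g \<noteq> azero B. \<pi> (F g) (u g \<xi>))"

text \<open>Families are normalised to be \<open>0\<close> at indices that are not covariant representations.\<close>

definition crossed_product ::
    "('g, 'm) monoid_scheme \<Rightarrow> 'g set \<Rightarrow> 'g set \<Rightarrow> 'g set \<Rightarrow> 'g univ_family star_algebra"
  where "crossed_product G N H M =
    \<lparr>carrier = {T. (\<forall>\<rho>\<in>cov_reps G N H M. bounded_clinear (T \<rho>)) \<and>
       (\<forall>\<rho>. \<rho> \<notin> cov_reps G N H M \<longrightarrow> T \<rho> = (\<lambda>_. 0)) \<and>
       (\<forall>\<epsilon>>0. \<exists>F\<in>fin_supp_funs G (D_alg G N H M). \<forall>(\<pi>, u)\<in>cov_reps G N H M.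
          onorm (\<lambda>\<xi>. T (\<pi>, u) \<xi> - integrated_form G (D_alg G N H M) \<pi> u F \<xi>) \<le> \<epsilon>)},
     azero = (\<lambda>_ _. 0),
     aadd = (\<lambda>S T \<rho> \<xi>. S \<rho> \<xi> + T \<rho> \<xi>),
     ascale = (\<lambda>c T \<rho> \<xi>. c *\<^sub>C T \<rho> \<xi>),
     amult = (\<lambda>S T \<rho>. S \<rho> \<circ> T \<rho>),
     astar = (\<lambda>T \<rho>. cadjoint (T \<rho>))\<rparr>"

text \<open>
  The multiplier algebra as the algebra of double centralizers; for a \<open>C\<^sup>*\<close>-algebra the
  linearity, boundedness and module properties of \<open>L\<close> and \<open>R\<close> follow from \<open>a L(b) = R(a) b\<close>.
\<close>

definition multiplier_algebra ::
    "('b, 'm) star_algebra_scheme \<Rightarrow> (('b \<Rightarrow> 'b) \<times> ('b \<Rightarrow> 'b)) star_algebra"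
  where "multiplier_algebra A =
    \<lparr>carrier = {(L, R). L \<in> carrier A \<rightarrow>\<^sub>E carrier A \<and> R \<in> carrier A \<rightarrow>\<^sub>E carrier A \<and>
       (\<forall>a\<in>carrier A. \<forall>b\<in>carrier A. amult A a (L b) = amult A (R a) b)},
     azero = ((\<lambda>a\<in>carrier A. azero A), (\<lambda>a\<in>carrier A. azero A)),
     aadd = (\<lambda>(L, R) (L', R'). ((\<lambda>a\<in>carrier A. aadd A (L a) (L' a)),
                                (\<lambda>a\<in>carrier A. aadd A (R a) (R' a)))),
     ascale = (\<lambda>c (L, R). ((\<lambda>a\<in>carrier A. ascale A c (L a)), (\<lambda>a\<in>carrier A. ascale A c (R a)))),
     amult = (\<lambda>(L, R) (L', R'). (compose (carrier A) L L', compose (carrier A) R' R)),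
     astar = (\<lambda>(L, R). ((\<lambda>a\<in>carrier A. astar A (R (astar A a))),
                        (\<lambda>a\<in>carrier A. astar A (L (astar A a)))))\<rparr>"

definition mult_by :: "('b, 'm) star_algebra_scheme \<Rightarrow> 'b \<Rightarrow> ('b \<Rightarrow> 'b) \<times> ('b \<Rightarrow> 'b)"
  where "mult_by A t = ((\<lambda>a\<in>carrier A. amult A t a), (\<lambda>a\<in>carrier A. amult A a t))"

type_synonym 'g crossed_multiplier =
  "('g univ_family \<Rightarrow> 'g univ_family) \<times> ('g univ_family \<Rightarrow> 'g univ_family)"

text \<open>
  The family \<open>(\<pi>(f))\<close> is an element of the crossed product and acts by multiplication; the
  family \<open>(u\<^sub>g)\<close> of unitaries is in general not an element, but multiplies the crossed product
  into itself.
\<close>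

definition i_D ::
    "('g, 'm) monoid_scheme \<Rightarrow> 'g set \<Rightarrow> 'g set \<Rightarrow> 'g set \<Rightarrow> ('g \<Rightarrow> complex) \<Rightarrow> 'g crossed_multiplier"
  where "i_D G N H M f = mult_by (crossed_product G N H M)
    (\<lambda>\<rho>. if \<rho> \<in> cov_reps G N H M then fst \<rho> f else (\<lambda>_. 0))"

definition i_G ::
    "('g, 'm) monoid_scheme \<Rightarrow> 'g set \<Rightarrow> 'g set \<Rightarrow> 'g set \<Rightarrow> 'g \<Rightarrow> 'g crossed_multiplier"
  where "i_G G N H M g = mult_by (crossed_product G N H M)
    (\<lambda>\<rho>. if \<rho> \<in> cov_reps G N H M then snd \<rho> g else (\<lambda>_. 0))"

definition gf_elem ::
    "('g, 'm) monoid_scheme \<Rightarrow> 'g set \<Rightarrow> 'g set \<Rightarrow> 'g set \<Rightarrow> 'g \<Rightarrow> ('g \<Rightarrow> complex) \<Rightarrow>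
     'g crossed_multiplier"
  where "gf_elem G N H M g f =
    amult (multiplier_algebra (crossed_product G N H M)) (i_G G N H M g) (i_D G N H M f)"

text \<open>
  The crossed product is identified with its image under \<^const>\<open>mult_by\<close> in its multiplier
  algebra, so the algebraic crossed product is a set of multipliers.
\<close>

definition algebraic_crossed_product ::
    "('g, 'm) monoid_scheme \<Rightarrow> 'g set \<Rightarrow> 'g set \<Rightarrow> 'g set \<Rightarrow> 'g crossed_multiplier star_algebra"
  where "algebraic_crossed_product G N H M =
    (multiplier_algebra (crossed_product G N H M))
      \<lparr>carrier := alg_span (multiplier_algebra (crossed_product G N H M))
         {gf_elem G N H M g f | g f. g \<in> carrier G \<and> f \<in> carrier (D0_alg G N H M)}\<rparr>"

end

theory Submission
  imports Defs
begin

text \<open>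
  The products \<open>g f\<close> span the algebraic crossed product, so uniqueness of \<open>\<Pi>\<close> is immediate and
  existence is the question whether \<open>\<Pi>\<close> is well defined: every relation \<open>\<Sum>\<^sub>i g\<^sub>i f\<^sub>i = 0\<close> in the
  crossed product must hold for the operators \<open>u\<^bsub>g\<^sub>i\<^esub> \<pi>(f\<^sub>i)\<close> as well.  Once this is known, \<open>\<Pi>\<close> is a
  \<open>*\<close>-homomorphism, because on both sides products and adjoints of such sums are computed by the
  same formulas, which use only covariance (\<open>covariant_pair.W_mult\<close>, \<open>covariant_pair.W_star\<close>).

  Relations are detected by one covariant representation of \<open>(D, G)\<close>.  The action \<open>\<beta>\<close> on \<open>N\<close> is
  left translation on \<open>G/H\<close>; in other words the projection \<open>npart : G \<rightarrow> N\<close> is equivariant.  Hence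
  multiplication by \<open>f \<circ> npart\<close> on \<open>\<ell>\<^sup>2(G)\<close> and left translation are covariant.  After collecting
  terms, \<open>\<Sum>\<^sub>g g f\<^sub>g\<close> sends the basis vector at \<open>h\<close> to the sum of \<open>f\<^sub>g(npart h)\<close> times the basis vector
  at \<open>g h\<close> (\<open>regular_word_coord\<close>).  If this is zero for all \<open>h\<close>, then every \<open>f\<^sub>g\<close> is zero, because \<open>npart\<close> maps
  onto \<open>N\<close>, and then \<open>\<Sum>\<^sub>g u\<^sub>g \<pi>(f\<^sub>g) = 0\<close> for every covariant \<open>(\<pi>, u)\<close>.

  Two further points carry weight.  The filter base and the finite quotients make \<open>D\<^sub>0\<close> closed under
  products (\<open>coset_funs_mult\<close>), hence also the span of the \<open>g f\<close>.  And the elements of the algebraic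
  crossed product are multipliers, while the computations take place in families of
  operators; \<open>multipliesI\<close> shows that \<open>i\<^sub>D(f)\<close> with \<open>f \<in> D\<^sub>0\<close> and \<open>i\<^sub>G(g)\<close> multiply the crossed product into
  itself, and the coefficients \<open>f\<^sub>g\<close> are recovered from a multiplier by applying it to indicator functions
  (\<open>word_elem_determines_coeff\<close>).
\<close>

section \<open>Bounded operators and their adjoints\<close>

lemma cinner_add_right: "cinner x (y + z) = cinner x y + cinner x z"
  by (metis cinner_add_left cinner_commute complex_cnj_add)

lemma cinner_scaleC_right: "cinner x (c *\<^sub>C y) = cnj c * cinner x y"
  by (metis cinner_commute cinner_scaleC_left complex_cnj_mult)

lemma scaleC_zero_left: "0 *\<^sub>C x = 0"
  using scaleC_of_real[of 0 x] by simp

lemma scaleC_zero_right: "c *\<^sub>C 0 = (0::'x::complex_inner)"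
  using scaleC_add_right[of c 0 "0::'x"] by simp

lemma cinner_zero_left: "cinner 0 x = 0"
  using cinner_scaleC_left[of 0 0 x] by (simp add: scaleC_zero_left)

lemma cinner_zero_right: "cinner x 0 = 0"
  using cinner_commute[of x 0] by (simp add: cinner_zero_left)

lemma cinner_diff_right: "cinner x (y - z) = cinner x y - cinner x z"
  using cinner_add_right[of x "y - z" z] by simp

lemma cinner_diff_left: "cinner (x - y) z = cinner x z - cinner y z"
  using cinner_add_left[of "x - y" y z] by simp

lemma Im_cinner: "Im (cinner x y) = - inner (\<i> *\<^sub>C x) y"
  by (simp add: inner_eq_Re_cinner cinner_scaleC_left)

lemma eq_if_cinner_eq:
  fixes y z :: "'x::complex_inner"
  assumes "\<And>x. cinner x y = cinner x z"
  shows "y = z"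
proof -
  have "inner (y - z) (y - z) = 0"
    using assms[of "y - z"] by (simp add: inner_eq_Re_cinner cinner_diff_right)
  then show ?thesis by simp
qed

lemma bounded_clinearI:
  assumes "\<And>x y. T (x + y) = T x + T y" and "\<And>c x. T (c *\<^sub>C x) = c *\<^sub>C T x"
    and "\<And>x. norm (T x) \<le> K * norm x"
  shows "bounded_clinear T"
  unfolding bounded_clinear_def
proof (intro conjI allI)
  show "bounded_linear T"
  proof (rule bounded_linear_intro)
    show "T (r *\<^sub>R x) = r *\<^sub>R T x" for r x
      using assms(2)[of "complex_of_real r" x] by (simp add: scaleC_of_real)
    show "norm (T x) \<le> norm x * K" for x using assms(3)[of x] by (simp add: mult.commute)
  qed (rule assms(1))
qed (rule assms(2))

lemma bounded_clinearD:
  assumes "bounded_clinear T"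
  shows "bounded_linear T" "T (c *\<^sub>C x) = c *\<^sub>C T x" "T (x + y) = T x + T y"
    "T (x - y) = T x - T y" "T 0 = 0"
  using assms unfolding bounded_clinear_def
  by (auto simp: linear_simps)

lemma bounded_clinear_zero: "bounded_clinear (\<lambda>_. 0)"
  by (rule bounded_clinearI[of _ 0]) (simp_all add: scaleC_zero_right)

lemma bounded_clinear_add:
  "bounded_clinear S \<Longrightarrow> bounded_clinear T \<Longrightarrow> bounded_clinear (\<lambda>x. S x + T x)"
  by (simp add: bounded_clinear_def bounded_linear_add scaleC_add_right)

lemma bounded_clinear_comp:
  "bounded_clinear S \<Longrightarrow> bounded_clinear T \<Longrightarrow> bounded_clinear (\<lambda>x. S (T x))"
  by (simp add: bounded_clinear_def bounded_linear_compose)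

lemma norm_scaleC: "norm (c *\<^sub>C y) = cmod c * norm y"
proof -
  have "cinner (c *\<^sub>C y) (c *\<^sub>C y) = complex_of_real ((cmod c)\<^sup>2) * cinner y y"
    unfolding cinner_scaleC_left cinner_scaleC_right complex_norm_square mult.assoc
    by (rule mult.left_commute)
  then have "(norm (c *\<^sub>C y))\<^sup>2 = (cmod c * norm y)\<^sup>2"
    by (simp add: power2_norm_eq_inner inner_eq_Re_cinner power_mult_distrib)
  then show ?thesis by (simp add: power2_eq_imp_eq)
qed

lemma bounded_clinear_scaleC:
  assumes "bounded_clinear T"
  shows "bounded_clinear (\<lambda>x. c *\<^sub>C T x)"
proof -
  have "bounded_clinear (\<lambda>y::'a. c *\<^sub>C y)"
    by (rule bounded_clinearI[of _ "cmod c"])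
      (simp_all add: norm_scaleC scaleC_add_right scaleC_scaleC mult.commute)
  then show ?thesis using assms by (rule bounded_clinear_comp)
qed

lemma is_adjoint_sym: "is_adjoint T S \<Longrightarrow> is_adjoint S T"
  unfolding is_adjoint_def by (metis cinner_commute)

lemma is_adjoint_unique: "is_adjoint T S \<Longrightarrow> is_adjoint T S' \<Longrightarrow> S = S'"
  unfolding is_adjoint_def by (intro ext eq_if_cinner_eq) metis

lemma cadjoint_eq: "is_adjoint T S \<Longrightarrow> cadjoint T = S"
  unfolding cadjoint_def using is_adjoint_unique by blast

lemma is_adjoint_inner: "is_adjoint T S \<Longrightarrow> inner (T x) y = inner x (S y)"
  by (simp add: is_adjoint_def inner_eq_Re_cinner)

text \<open>
  The imaginary part of \<open>cinner\<close> is the real inner product after rotating the first argument by \<open>\<i>\<close>,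
  so for a complex linear \<open>T\<close> the real adjoint relation suffices.
\<close>

lemma is_adjointI_inner:
  assumes "\<And>x. T (\<i> *\<^sub>C x) = \<i> *\<^sub>C T x" and "\<And>x y. inner (T x) y = inner x (S y)"
  shows "is_adjoint T S"
  unfolding is_adjoint_def
proof (intro allI complex_eqI)
  fix x y
  show "Re (cinner (T x) y) = Re (cinner x (S y))"
    using assms(2) by (simp add: inner_eq_Re_cinner)
  show "Im (cinner (T x) y) = Im (cinner x (S y))"
    by (simp add: Im_cinner assms flip: assms(1))
qed

lemma is_adjoint_zero: "is_adjoint (\<lambda>_. 0) (\<lambda>_. 0)"
  by (simp add: is_adjoint_def cinner_zero_left cinner_zero_right)

lemma is_adjoint_add:
  "is_adjoint S S' \<Longrightarrow> is_adjoint T T' \<Longrightarrow> is_adjoint (\<lambda>x. S x + T x) (\<lambda>x. S' x + T' x)"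
  by (simp add: is_adjoint_def cinner_add_left cinner_add_right)

lemma is_adjoint_diff:
  "is_adjoint S S' \<Longrightarrow> is_adjoint T T' \<Longrightarrow> is_adjoint (\<lambda>x. S x - T x) (\<lambda>x. S' x - T' x)"
  by (simp add: is_adjoint_def cinner_diff_left cinner_diff_right)

lemma is_adjoint_comp:
  "is_adjoint S S' \<Longrightarrow> is_adjoint T T' \<Longrightarrow> is_adjoint (\<lambda>x. S (T x)) (\<lambda>x. T' (S' x))"
  by (simp add: is_adjoint_def)

text \<open>
  Evaluating \<open>\<langle>T (S y), y\<rangle> = \<parallel>S y\<parallel>\<^sup>2\<close> bounds an adjoint by any norm bound of the operator; in
  particular the boundedness of \<open>S\<close> is a consequence.
\<close>

lemma adjoint_norm_le:
  assumes "is_adjoint T S" and "\<And>x. norm (T x) \<le> K * norm x"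
  shows "norm (S y) \<le> K * norm y"
proof (cases "S y = 0")
  case True
  have "0 \<le> K * norm y" using assms(2)[of y] norm_ge_zero order_trans by blast
  with True show ?thesis by simp
next
  case False
  have "norm (S y) * norm (S y) = inner (T (S y)) y"
    using is_adjoint_inner[OF assms(1), of "S y" y]
    by (simp add: power2_norm_eq_inner flip: power2_eq_square)
  also have "\<dots> \<le> norm (T (S y)) * norm y" by (rule norm_cauchy_schwarz)
  also have "\<dots> \<le> (K * norm (S y)) * norm y" by (intro mult_right_mono assms(2)) simp
  finally have "norm (S y) * norm (S y) \<le> norm (S y) * (K * norm y)" by (simp add: ac_simps)
  with False show ?thesis by simp
qed

lemma adjoint_bounded_clinear:
  assumes "is_adjoint T S" "bounded_clinear T"
  shows "bounded_clinear S"
proof -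
  obtain K where K: "\<And>x. norm (T x) \<le> K * norm x"
    using bounded_linear.bounded[OF bounded_clinearD(1)[OF assms(2)]] by (auto simp: mult.commute)
  have S: "cinner x (S y) = cinner (T x) y" for x y
    using assms(1) by (simp add: is_adjoint_def)
  show ?thesis
  proof (rule bounded_clinearI)
    show "S (x + y) = S x + S y" for x y
      by (rule eq_if_cinner_eq) (simp add: S cinner_add_right)
    show "S (c *\<^sub>C x) = c *\<^sub>C S x" for c x
      by (rule eq_if_cinner_eq) (simp add: S cinner_scaleC_right)
    show "norm (S y) \<le> K * norm y" for y by (rule adjoint_norm_le[OF assms(1) K])
  qed
qed

text \<open>
  Adjointable operators form a norm closed set: the adjoints of approximants of \<open>T\<close> are
  pointwise Cauchy by \<open>adjoint_norm_le\<close>, and their limit is adjoint to \<open>T\<close>.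
\<close>

lemma adjoint_of_norm_limit:
  fixes T :: "'x::complex_hilbert \<Rightarrow> 'x"
  assumes T: "\<And>x. T (\<i> *\<^sub>C x) = \<i> *\<^sub>C T x"
    and approx: "\<And>\<epsilon>. 0 < \<epsilon> \<Longrightarrow> \<exists>T' S'. is_adjoint T' S' \<and> (\<forall>x. norm (T x - T' x) \<le> \<epsilon> * norm x)"
  shows "\<exists>S. is_adjoint T S"
proof -
  have "\<exists>T' S'. is_adjoint T' S' \<and> (\<forall>x. norm (T x - T' x) \<le> inverse (real (Suc n)) * norm x)" for n
    by (rule approx) simp
  then obtain T' S' where adj: "\<And>n. is_adjoint (T' n) (S' n)"
    and T': "\<And>n x. norm (T x - T' n x) \<le> inverse (real (Suc n)) * norm x"
    by metis
  have diff: "norm (S' m y - S' n y) \<le> (inverse (real (Suc m)) + inverse (real (Suc n))) * norm y"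
    for m n y
  proof (rule adjoint_norm_le)
    show "is_adjoint (\<lambda>x. T' m x - T' n x) (\<lambda>y. S' m y - S' n y)"
      using adj[of m] adj[of n] by (rule is_adjoint_diff)
    show "norm (T' m x - T' n x) \<le> (inverse (real (Suc m)) + inverse (real (Suc n))) * norm x" for x
    proof -
      have "norm (T' m x - T' n x) \<le> norm (T x - T' m x) + norm (T x - T' n x)"
        using norm_triangle_ineq4[of "T x - T' n x" "T x - T' m x"] by simp
      with T'[of x m] T'[of x n] show ?thesis by (simp add: distrib_right)
    qed
  qed
  have "Cauchy (\<lambda>n. S' n y)" for y
  proof (rule CauchyI)
    fix e :: real assume "0 < e"
    have "(\<lambda>n. inverse (real (Suc n)) * norm y) \<longlonglongrightarrow> 0"
      by (rule tendsto_mult_left_zero[OF LIMSEQ_inverse_real_of_nat])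
    then have "\<forall>\<^sub>F n in sequentially. inverse (real (Suc n)) * norm y < e / 2"
      using \<open>0 < e\<close> by (intro order_tendstoD(2)) auto
    then obtain K where K: "\<And>n. n \<ge> K \<Longrightarrow> inverse (real (Suc n)) * norm y < e / 2"
      unfolding eventually_sequentially by blast
    have "norm (S' m y - S' n y) < e" if "m \<ge> K" "n \<ge> K" for m n
      using diff[of m y n] K[OF that(1)] K[OF that(2)] by (simp add: distrib_right)
    then show "\<exists>K. \<forall>m\<ge>K. \<forall>n\<ge>K. norm (S' m y - S' n y) < e" by blast
  qed
  then have S: "(\<lambda>n. S' n y) \<longlonglongrightarrow> lim (\<lambda>n. S' n y)" for y
    by (simp add: Cauchy_convergent_iff convergent_LIMSEQ_iff)
  have "(\<lambda>n. T' n x) \<longlonglongrightarrow> T x" for x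
  proof (rule LIM_zero_cancel, rule Lim_null_comparison)
    show "\<forall>\<^sub>F n in sequentially. norm (T' n x - T x) \<le> inverse (real (Suc n)) * norm x"
      using T' by (simp add: norm_minus_commute)
    show "(\<lambda>n. inverse (real (Suc n)) * norm x) \<longlonglongrightarrow> 0"
      by (rule tendsto_mult_left_zero[OF LIMSEQ_inverse_real_of_nat])
  qed
  then have "(\<lambda>n. inner (T' n x) y) \<longlonglongrightarrow> inner (T x) y" for x y
    by (intro tendsto_intros)
  moreover have "(\<lambda>n. inner (T' n x) y) \<longlonglongrightarrow> inner x (lim (\<lambda>n. S' n y))" for x y
    unfolding is_adjoint_inner[OF adj] by (intro tendsto_intros S)
  ultimately have "inner (T x) y = inner x (lim (\<lambda>n. S' n y))" for x y
    using LIMSEQ_unique by blast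
  then have "is_adjoint T (\<lambda>y. lim (\<lambda>n. S' n y))" by (intro is_adjointI_inner T)
  then show ?thesis by blast
qed

lemma bounded_clinear_minus:
  assumes "bounded_clinear S" "bounded_clinear T"
  shows "bounded_clinear (\<lambda>x. S x - T x)"
proof -
  have "(- 1) *\<^sub>C x = - x" for x :: 'a using scaleC_of_real[of "-1" x] by simp
  then show ?thesis
    using bounded_clinear_add[OF assms(1) bounded_clinear_scaleC[OF assms(2), of "-1"]] by simp
qed

lemma onorm_le_iff:
  assumes "bounded_clinear T" "0 \<le> K"
  shows "onorm T \<le> K \<longleftrightarrow> (\<forall>x. norm (T x) \<le> K * norm x)"
proof
  assume "onorm T \<le> K"
  then show "\<forall>x. norm (T x) \<le> K * norm x"
    using onorm[OF bounded_clinearD(1)[OF assms(1)]] by (meson mult_right_mono norm_ge_zero order_trans)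
qed (auto intro: onorm_bound assms)

lemma unitary_opD:
  assumes "unitary_op T"
  shows "bounded_clinear T" "norm (T x) = norm x" "inj T" "surj T"
proof -
  show "bounded_clinear T" "surj T" using assms by (auto simp: unitary_op_def)
  have iso: "norm (T x) = norm x" for x
    using assms by (simp add: unitary_op_def norm_eq_sqrt_inner inner_eq_Re_cinner)
  then show "norm (T x) = norm x" .
  show "inj T"
  proof (rule injI)
    fix x y assume "T x = T y"
    then have "norm (T (x - y)) = 0"
      by (simp add: bounded_clinearD(4)[OF \<open>bounded_clinear T\<close>])
    then show "x = y" by (simp add: iso)
  qed
qed

section \<open>The action of a semidirect product on its normal factor\<close>

locale semidirect =
  fixes G :: "('g, 'm) monoid_scheme" (structure) and N H :: "'g set"
  assumes semidirect: "semidirect_product G N H"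

sublocale semidirect \<subseteq> group G
  using semidirect by (simp add: semidirect_product_def)

context semidirect
begin

lemma N_normal: "N \<lhd> G" and H_subgroup: "subgroup H G" and N_int_H: "N \<inter> H = {\<one>}"
  and N_times_H: "N <#> H = carrier G"
  using semidirect by (simp_all add: semidirect_product_def)

lemma N_subgroup: "subgroup N G"
  using N_normal by (rule normal_imp_subgroup)

lemma N_carrier: "x \<in> N \<Longrightarrow> x \<in> carrier G"
  by (rule subgroup.mem_carrier[OF N_subgroup])

lemma H_carrier: "a \<in> H \<Longrightarrow> a \<in> carrier G"
  by (rule subgroup.mem_carrier[OF H_subgroup])

lemmas N_closed = subgroup.m_closed[OF N_subgroup] subgroup.m_inv_closed[OF N_subgroup]
  subgroup.one_closed[OF N_subgroup]

lemmas H_closed = subgroup.m_closed[OF H_subgroup] subgroup.m_inv_closed[OF H_subgroup]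
  subgroup.one_closed[OF H_subgroup]

lemma N_conj: "g \<in> carrier G \<Longrightarrow> x \<in> N \<Longrightarrow> g \<otimes> x \<otimes> inv g \<in> N"
  using N_normal normal_inv_iff by blast

lemma decomposition_unique:
  assumes "x \<in> N" "a \<in> H" "y \<in> N" "b \<in> H" "x \<otimes> a = y \<otimes> b"
  shows "x = y" "a = b"
proof -
  have c: "x \<in> carrier G" "a \<in> carrier G" "y \<in> carrier G" "b \<in> carrier G"
    using assms N_carrier H_carrier by auto
  have eq: "inv y \<otimes> x = b \<otimes> inv a"
  proof -
    have "inv y \<otimes> x = inv y \<otimes> (x \<otimes> a) \<otimes> inv a" using c by (simp add: m_assoc)
    also have "\<dots> = b \<otimes> inv a" using c assms(5) by (simp add: m_assoc[symmetric])
    finally show ?thesis .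
  qed
  have "inv y \<otimes> x \<in> N" "b \<otimes> inv a \<in> H" using assms N_closed H_closed by auto
  with eq N_int_H have "inv y \<otimes> x = \<one>" "b \<otimes> inv a = \<one>" by auto
  then show "x = y" "a = b" using c by (metis inv_equality inv_inv inv_closed)+
qed

lemma npart_mult: "x \<in> N \<Longrightarrow> a \<in> H \<Longrightarrow> npart G N H (x \<otimes> a) = x"
  and hpart_mult: "x \<in> N \<Longrightarrow> a \<in> H \<Longrightarrow> hpart G N H (x \<otimes> a) = a"
  unfolding npart_def hpart_def by (rule the_equality; use decomposition_unique in blast)+

lemma decomposition:
  assumes "g \<in> carrier G"
  shows "npart G N H g \<in> N" "hpart G N H g \<in> H" "npart G N H g \<otimes> hpart G N H g = g"
proof -
  obtain x a where "x \<in> N" "a \<in> H" "g = x \<otimes> a"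
    using assms unfolding N_times_H[symmetric] set_mult_def by blast
  then show "npart G N H g \<in> N" "hpart G N H g \<in> H" "npart G N H g \<otimes> hpart G N H g = g"
    by (simp_all add: npart_mult hpart_mult)
qed

lemma npart_N: "x \<in> N \<Longrightarrow> npart G N H x = x"
  using npart_mult[of x \<one>] H_closed(3) N_carrier by simp

text \<open>
  \<open>N\<close> is the homogeneous space \<open>G/H\<close>: the coset of \<open>g\<close> is represented by \<open>npart g\<close>, and
  \<open>\<beta>\<close> is left translation of cosets.  This makes \<open>\<beta>\<close> an action and \<open>npart\<close> equivariant.
\<close>

lemma npart_mult_npart:
  assumes "g \<in> carrier G" "k \<in> carrier G"
  shows "npart G N H (g \<otimes> npart G N H k) = npart G N H (g \<otimes> k)"
proof -
  let ?x = "npart G N H" and ?a = "hpart G N H"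
  have c: "?x k \<in> carrier G" "?a k \<in> carrier G"
    using decomposition[OF assms(2)] N_carrier H_carrier by auto
  then have gk: "g \<otimes> ?x k \<in> carrier G" using assms by simp
  have c': "?x (g \<otimes> ?x k) \<in> carrier G" "?a (g \<otimes> ?x k) \<in> carrier G"
    using decomposition[OF gk] N_carrier H_carrier by auto
  have "g \<otimes> k = g \<otimes> ?x k \<otimes> ?a k"
    using decomposition(3)[OF assms(2)] assms c by (simp add: m_assoc)
  also have "\<dots> = ?x (g \<otimes> ?x k) \<otimes> (?a (g \<otimes> ?x k) \<otimes> ?a k)"
    using decomposition(3)[OF gk] c c' by (simp add: m_assoc[symmetric])
  finally show ?thesis
    using npart_mult decomposition[OF gk] decomposition[OF assms(2)] H_closed(1) by simp
qed

lemma beta_eq_npart: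
  assumes "g \<in> carrier G" "y \<in> N"
  shows "beta G N H g y = npart G N H (g \<otimes> y)"
proof -
  let ?x = "npart G N H g" and ?a = "hpart G N H g"
  note d = decomposition[OF assms(1)]
  have c: "?x \<in> carrier G" "?a \<in> carrier G" "y \<in> carrier G"
    using d assms N_carrier H_carrier by auto
  have "g \<otimes> y = ?x \<otimes> ?a \<otimes> y" by (simp add: d(3))
  also have "\<dots> = (?x \<otimes> (?a \<otimes> y \<otimes> inv ?a)) \<otimes> ?a" using c by (simp add: m_assoc)
  finally have "npart G N H (g \<otimes> y) = ?x \<otimes> (?a \<otimes> y \<otimes> inv ?a)"
    using npart_mult N_closed(1)[OF d(1) N_conj[OF c(2) assms(2)]] d(2) by simp
  then show ?thesis using c by (simp add: beta_def m_assoc)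
qed

lemma beta_closed: "g \<in> carrier G \<Longrightarrow> y \<in> N \<Longrightarrow> beta G N H g y \<in> N"
  by (simp add: beta_eq_npart decomposition N_carrier)

lemma beta_mult:
  "g \<in> carrier G \<Longrightarrow> h \<in> carrier G \<Longrightarrow> y \<in> N \<Longrightarrow>
    beta G N H (g \<otimes> h) y = beta G N H g (beta G N H h y)"
  by (simp add: beta_eq_npart decomposition N_carrier npart_mult_npart m_assoc)

lemma beta_one: "y \<in> N \<Longrightarrow> beta G N H \<one> y = y"
  by (simp add: beta_eq_npart N_carrier npart_N)

lemma beta_inv: "g \<in> carrier G \<Longrightarrow> y \<in> N \<Longrightarrow> beta G N H g (beta G N H (inv g) y) = y"
  "g \<in> carrier G \<Longrightarrow> y \<in> N \<Longrightarrow> beta G N H (inv g) (beta G N H g y) = y"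
  using beta_mult[of g "inv g" y] beta_mult[of "inv g" g y] by (simp_all add: beta_one)

lemma beta_npart:
  "g \<in> carrier G \<Longrightarrow> h \<in> carrier G \<Longrightarrow> beta G N H g (npart G N H h) = npart G N H (g \<otimes> h)"
  by (simp add: beta_eq_npart decomposition npart_mult_npart)

abbreviation act :: "'g \<Rightarrow> ('g \<Rightarrow> complex) \<Rightarrow> 'g \<Rightarrow> complex"
  where "act \<equiv> alpha G N H"

lemma act_mult:
  assumes "g \<in> carrier G" "h \<in> carrier G"
  shows "act (g \<otimes> h) f = act g (act h f)"
  using assms by (auto simp: alpha_def inv_mult_group beta_mult beta_closed)

lemma act_one: "(\<And>y. y \<notin> N \<Longrightarrow> f y = 0) \<Longrightarrow> act \<one> f = f"
  by (auto simp: alpha_def beta_one)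

lemma act_inv:
  assumes "g \<in> carrier G" "\<And>y. y \<notin> N \<Longrightarrow> f y = 0"
  shows "act g (act (inv g) f) = f" "act (inv g) (act g f) = f"
  using assms by (simp_all add: act_one flip: act_mult)

lemma act_algebra:
  "act g (\<lambda>_. 0) = (\<lambda>_. 0)" "act g (\<lambda>y. f y + k y) = (\<lambda>y. act g f y + act g k y)"
  "act g (\<lambda>y. c * f y) = (\<lambda>y. c * act g f y)" "act g (\<lambda>y. f y * k y) = (\<lambda>y. act g f y * act g k y)"
  "act g (\<lambda>y. cnj (f y)) = (\<lambda>y. cnj (act g f y))"
  by (auto simp: alpha_def)

lemma act_outside: "y \<notin> N \<Longrightarrow> act g f y = 0"
  by (simp add: alpha_def)

end

lemma (in group) unitary_representation_one:
  assumes "unitary_representation G u"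
  shows "u \<one> \<xi> = \<xi>"
proof -
  have "u (g \<otimes> h) \<xi> = u g (u h \<xi>)" if "g \<in> carrier G" "h \<in> carrier G" for g h
    using assms that by (simp add: unitary_representation_def)
  from this[of \<one> \<one>] have "u \<one> (u \<one> \<xi>) = u \<one> \<xi>" by simp
  moreover have "inj (u \<one>)"
    using assms by (simp add: unitary_representation_def unitary_opD(3))
  ultimately show ?thesis by (simp add: inj_eq)
qed

lemma (in group) unitary_representation_inv:
  assumes "unitary_representation G u" "g \<in> carrier G"
  shows "u g (u (inv g) \<xi>) = \<xi>" "u (inv g) (u g \<xi>) = \<xi>"
proof -
  have "u (g \<otimes> h) \<xi> = u g (u h \<xi>)" if "g \<in> carrier G" "h \<in> carrier G" for g h
    using assms that by (simp add: unitary_representation_def)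
  from this[of g "inv g"] this[of "inv g" g]
  show "u g (u (inv g) \<xi>) = \<xi>" "u (inv g) (u g \<xi>) = \<xi>"
    using assms by (simp_all add: unitary_representation_one)
qed

lemma (in group) unitary_representation_adjoint:
  assumes "unitary_representation G u" "g \<in> carrier G"
  shows "is_adjoint (u g) (u (inv g))"
  unfolding is_adjoint_def
proof (intro allI)
  fix x y
  have "unitary_op (u g)" using assms by (simp add: unitary_representation_def)
  then have "cinner (u g x) (u g (u (inv g) y)) = cinner x (u (inv g) y)"
    by (simp add: unitary_op_def)
  then show "cinner (u g x) y = cinner x (u (inv g) y)"
    using assms by (simp add: unitary_representation_inv)
qed

section \<open>Formal sums of products and their integrated forms\<close>

text \<open>
  \<open>\<alpha>\<close>-invariant \<open>*\<close>-algebras of functions on \<open>N\<close>; both \<open>D\<close> and \<open>D\<^sub>0\<close> are of this form.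
\<close>

locale invariant_algebra = semidirect G N H
  for G :: "('g, 'm) monoid_scheme" (structure) and N H :: "'g set" +
  fixes C :: "('g \<Rightarrow> complex) set"
  assumes C_linf: "C \<subseteq> carrier (linf N)"
    and C_zero: "(\<lambda>_. 0) \<in> C"
    and C_add: "f \<in> C \<Longrightarrow> k \<in> C \<Longrightarrow> (\<lambda>y. f y + k y) \<in> C"
    and C_mult: "f \<in> C \<Longrightarrow> k \<in> C \<Longrightarrow> (\<lambda>y. f y * k y) \<in> C"
    and C_scale: "f \<in> C \<Longrightarrow> (\<lambda>y. c * f y) \<in> C"
    and C_cnj: "f \<in> C \<Longrightarrow> (\<lambda>y. cnj (f y)) \<in> C"
    and C_act: "f \<in> C \<Longrightarrow> g \<in> carrier G \<Longrightarrow> alpha G N H g f \<in> C"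
begin

lemma C_outside: "f \<in> C \<Longrightarrow> y \<notin> N \<Longrightarrow> f y = 0"
  and C_bounded: "f \<in> C \<Longrightarrow> bounded (range f)"
  using C_linf by (auto simp: linf_def)

definition C_alg :: "('g \<Rightarrow> complex) star_algebra"
  where "C_alg = (linf N)\<lparr>carrier := C\<rparr>"

lemma C_alg_simps: "carrier C_alg = C" "azero C_alg = (\<lambda>_. 0)"
  "aadd C_alg f k = (\<lambda>y. f y + k y)" "ascale C_alg c f = (\<lambda>y. c * f y)"
  "amult C_alg f k = (\<lambda>y. f y * k y)" "astar C_alg f = (\<lambda>y. cnj (f y))"
  by (simp_all add: C_alg_def linf_def)

text \<open>
  The word \<open>[(g\<^sub>1, f\<^sub>1), \<dots>]\<close> stands for the formal sum of the \<open>g\<^sub>i f\<^sub>i\<close>.  The operations below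
  are those of the algebraic crossed product, read off from \<open>f g = g \<alpha>\<^bsub>g\<^sup>-\<^sup>1\<^esub>(f)\<close>.
\<close>

definition words :: "('g \<times> ('g \<Rightarrow> complex)) list set"
  where "words = lists (carrier G \<times> C)"

lemma words_simps: "[] \<in> words" "p # xs \<in> words \<longleftrightarrow> fst p \<in> carrier G \<and> snd p \<in> C \<and> xs \<in> words"
  "xs @ ys \<in> words \<longleftrightarrow> xs \<in> words \<and> ys \<in> words"
  by (auto simp: words_def mem_Times_iff)

lemma words_map:
  assumes "xs \<in> words" and "\<And>g f. g \<in> carrier G \<Longrightarrow> f \<in> C \<Longrightarrow> \<phi> (g, f) \<in> carrier G \<times> C"
  shows "map \<phi> xs \<in> words"
  using assms unfolding words_def by fastforce

definition word_scale where "word_scale c = map (\<lambda>(g, f). (g, \<lambda>y. c * f y))"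

definition word_star where "word_star = map (\<lambda>(g, f). (inv g, alpha G N H g (\<lambda>y. cnj (f y))))"

definition word_lmult_fun where
  "word_lmult_fun k = map (\<lambda>(g, f). (g, \<lambda>y. alpha G N H (inv g) k y * f y))"

definition word_rmult_fun where "word_rmult_fun k = map (\<lambda>(g, f). (g, \<lambda>y. f y * k y))"

definition word_lmult_group where "word_lmult_group h = map (\<lambda>(g, f). (h \<otimes> g, f))"

definition word_rmult_group where
  "word_rmult_group h = map (\<lambda>(g, f). (g \<otimes> h, alpha G N H (inv h) f))"

definition word_mult where
  "word_mult xs ys = concat (map (\<lambda>(g, f). word_lmult_group g (word_lmult_fun f ys)) xs)"

lemma word_scale_in: "xs \<in> words \<Longrightarrow> word_scale c xs \<in> words"
  and word_star_in: "xs \<in> words \<Longrightarrow> word_star xs \<in> words"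
  and word_lmult_fun_in: "xs \<in> words \<Longrightarrow> k \<in> C \<Longrightarrow> word_lmult_fun k xs \<in> words"
  and word_rmult_fun_in: "xs \<in> words \<Longrightarrow> k \<in> C \<Longrightarrow> word_rmult_fun k xs \<in> words"
  and word_lmult_group_in: "xs \<in> words \<Longrightarrow> h \<in> carrier G \<Longrightarrow> word_lmult_group h xs \<in> words"
  and word_rmult_group_in: "xs \<in> words \<Longrightarrow> h \<in> carrier G \<Longrightarrow> word_rmult_group h xs \<in> words"
  unfolding word_scale_def word_star_def word_lmult_fun_def word_rmult_fun_def
    word_lmult_group_def word_rmult_group_def
  by (erule words_map; simp add: C_scale C_cnj C_act C_mult)+

lemma word_mult_in:
  assumes "xs \<in> words" "ys \<in> words"
  shows "word_mult xs ys \<in> words"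
  using assms(1)
proof (induction xs)
  case (Cons p xs)
  then show ?case using assms(2)
    by (cases p) (simp add: word_mult_def words_simps word_lmult_group_in word_lmult_fun_in)
qed (simp add: word_mult_def words_simps)

definition coeff :: "('g \<times> ('g \<Rightarrow> complex)) list \<Rightarrow> 'g \<Rightarrow> 'g \<Rightarrow> complex"
  where "coeff xs g = (\<lambda>y. \<Sum>(h, f)\<leftarrow>xs. if h = g then f y else 0)"

lemma coeff_Nil: "coeff [] g = (\<lambda>_. 0)"
  by (simp add: coeff_def)

lemma coeff_Cons: "coeff ((h, f) # xs) g = (if h = g then \<lambda>y. f y + coeff xs g y else coeff xs g)"
  by (auto simp: coeff_def)

lemma coeff_in: "xs \<in> words \<Longrightarrow> coeff xs g \<in> C"
proof (induction xs)
  case (Cons p xs)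
  then show ?case by (cases p) (auto simp: coeff_Cons words_simps C_add)
qed (simp add: coeff_Nil C_zero)

lemma coeff_eq_zero: "g \<notin> fst ` set xs \<Longrightarrow> coeff xs g = (\<lambda>_. 0)"
proof (induction xs)
  case (Cons p xs)
  then show ?case by (cases p) (auto simp: coeff_Cons)
qed (simp add: coeff_Nil)

end

definition word_op ::
    "('f \<Rightarrow> 'x \<Rightarrow> 'x) \<Rightarrow> ('g \<Rightarrow> 'x \<Rightarrow> 'x) \<Rightarrow> ('g \<times> 'f) list \<Rightarrow> 'x \<Rightarrow> 'x::complex_hilbert"
  where "word_op \<pi> u xs \<xi> = (\<Sum>(g, f)\<leftarrow>xs. u g (\<pi> f \<xi>))"

lemma word_op_Nil: "word_op \<pi> u [] = (\<lambda>_. 0)"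
  and word_op_Cons: "word_op \<pi> u ((g, f) # xs) = (\<lambda>\<xi>. u g (\<pi> f \<xi>) + word_op \<pi> u xs \<xi>)"
  and word_op_append: "word_op \<pi> u (xs @ ys) = (\<lambda>\<xi>. word_op \<pi> u xs \<xi> + word_op \<pi> u ys \<xi>)"
  by (simp_all add: word_op_def fun_eq_iff)

locale covariant_pair = invariant_algebra G N H C
  for G :: "('g, 'm) monoid_scheme" (structure) and N H :: "'g set" and C +
  fixes \<pi> :: "('g \<Rightarrow> complex) \<Rightarrow> 'x \<Rightarrow> 'x::complex_hilbert" and u :: "'g \<Rightarrow> 'x \<Rightarrow> 'x"
  assumes covariant: "covariant_representation G N H C_alg \<pi> u"
begin

lemma
  shows pi_bounded: "f \<in> C \<Longrightarrow> bounded_clinear (\<pi> f)"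
    and pi_add: "f \<in> C \<Longrightarrow> k \<in> C \<Longrightarrow> \<pi> (\<lambda>y. f y + k y) \<xi> = \<pi> f \<xi> + \<pi> k \<xi>"
    and pi_scale: "f \<in> C \<Longrightarrow> \<pi> (\<lambda>y. c * f y) \<xi> = c *\<^sub>C \<pi> f \<xi>"
    and pi_mult: "f \<in> C \<Longrightarrow> k \<in> C \<Longrightarrow> \<pi> (\<lambda>y. f y * k y) \<xi> = \<pi> f (\<pi> k \<xi>)"
    and pi_star: "f \<in> C \<Longrightarrow> is_adjoint (\<pi> f) (\<pi> (\<lambda>y. cnj (f y)))"
    and u_unitary: "g \<in> carrier G \<Longrightarrow> unitary_op (u g)"
    and u_mult: "g \<in> carrier G \<Longrightarrow> h \<in> carrier G \<Longrightarrow> u (g \<otimes> h) \<xi> = u g (u h \<xi>)"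
    and covariance: "g \<in> carrier G \<Longrightarrow> f \<in> C \<Longrightarrow>
      u g (\<pi> f (cadjoint (u g) \<xi>)) = \<pi> (alpha G N H g f) \<xi>"
proof -
  have cov: "representation C_alg \<pi>" "unitary_representation G u"
    "\<And>g f. g \<in> carrier G \<Longrightarrow> f \<in> C \<Longrightarrow> u g \<circ> \<pi> f \<circ> cadjoint (u g) = \<pi> (alpha G N H g f)"
    using covariant by (auto simp: covariant_representation_def C_alg_simps)
  show "f \<in> C \<Longrightarrow> bounded_clinear (\<pi> f)" "f \<in> C \<Longrightarrow> is_adjoint (\<pi> f) (\<pi> (\<lambda>y. cnj (f y)))"
    "f \<in> C \<Longrightarrow> k \<in> C \<Longrightarrow> \<pi> (\<lambda>y. f y + k y) \<xi> = \<pi> f \<xi> + \<pi> k \<xi>"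
    "f \<in> C \<Longrightarrow> \<pi> (\<lambda>y. c * f y) \<xi> = c *\<^sub>C \<pi> f \<xi>"
    "f \<in> C \<Longrightarrow> k \<in> C \<Longrightarrow> \<pi> (\<lambda>y. f y * k y) \<xi> = \<pi> f (\<pi> k \<xi>)"
    using cov(1) by (simp_all add: representation_def C_alg_simps)
  show "g \<in> carrier G \<Longrightarrow> unitary_op (u g)"
    "g \<in> carrier G \<Longrightarrow> h \<in> carrier G \<Longrightarrow> u (g \<otimes> h) \<xi> = u g (u h \<xi>)"
    using cov(2) by (simp_all add: unitary_representation_def)
  show "g \<in> carrier G \<Longrightarrow> f \<in> C \<Longrightarrow> u g (\<pi> f (cadjoint (u g) \<xi>)) = \<pi> (alpha G N H g f) \<xi>"
    using fun_cong[OF cov(3), of g f \<xi>] by simp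
qed

lemma pi_zero: "\<pi> (\<lambda>_. 0) \<xi> = 0"
  using pi_scale[OF C_zero, of 0 \<xi>] by (simp add: scaleC_zero_left)

lemmas u_bounded = unitary_opD(1)[OF u_unitary] and u_norm = unitary_opD(2)[OF u_unitary]

lemma u_representation: "unitary_representation G u"
  using covariant by (simp add: covariant_representation_def)

lemmas u_one = unitary_representation_one[OF u_representation]
  and u_inv = unitary_representation_inv[OF u_representation]
  and u_adjoint = unitary_representation_adjoint[OF u_representation]

lemma u_pi: 
  assumes "g \<in> carrier G" "f \<in> C"
  shows "u g (\<pi> f \<xi>) = \<pi> (alpha G N H g f) (u g \<xi>)"
  using covariance[OF assms, of "u g \<xi>"] cadjoint_eq[OF u_adjoint[OF assms(1)]] assms
  by (simp add: u_inv)

lemma pi_u: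
  assumes "g \<in> carrier G" "f \<in> C"
  shows "\<pi> f (u g \<xi>) = u g (\<pi> (alpha G N H (inv g) f) \<xi>)"
  using u_pi[OF assms(1) C_act[OF assms(2)], of "inv g"] assms
  by (simp add: act_inv(1)[OF assms(1) C_outside[OF assms(2)]])

abbreviation W where "W \<equiv> word_op \<pi> u"

lemma W_bounded: "xs \<in> words \<Longrightarrow> bounded_clinear (W xs)"
proof (induction xs)
  case (Cons p xs)
  then show ?case
    by (cases p) (auto simp: word_op_Cons words_simps
        intro!: bounded_clinear_add bounded_clinear_comp[OF u_bounded pi_bounded])
qed (simp add: word_op_Nil bounded_clinear_zero)

lemma W_scale: "xs \<in> words \<Longrightarrow> W (word_scale c xs) \<xi> = c *\<^sub>C W xs \<xi>"
proof (induction xs)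
  case (Cons p xs)
  then show ?case
    by (cases p) (simp add: word_op_Cons words_simps word_scale_def pi_scale scaleC_add_right
        bounded_clinearD(2)[OF u_bounded])
qed (simp add: word_op_Nil word_scale_def scaleC_zero_right)

lemma W_star: "xs \<in> words \<Longrightarrow> is_adjoint (W xs) (W (word_star xs))"
proof (induction xs)
  case (Cons p xs)
  obtain g f where p: "p = (g, f)" by fastforce
  with Cons have in': "g \<in> carrier G" "f \<in> C" "xs \<in> words" by (auto simp: words_simps)
  have "is_adjoint (\<lambda>\<xi>. u g (\<pi> f \<xi>) + W xs \<xi>)
      (\<lambda>\<xi>. \<pi> (\<lambda>y. cnj (f y)) (u (inv g) \<xi>) + W (word_star xs) \<xi>)"
    using is_adjoint_add[OF is_adjoint_comp[OF u_adjoint pi_star] Cons.IH] in' by blast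
  then show ?case
    using in' pi_u[OF inv_closed[OF in'(1)] C_cnj[OF in'(2)]]
    by (simp add: p word_op_Cons word_star_def)
qed (simp add: word_op_Nil word_star_def is_adjoint_zero)

lemma W_lmult_fun: "xs \<in> words \<Longrightarrow> k \<in> C \<Longrightarrow> W (word_lmult_fun k xs) \<xi> = \<pi> k (W xs \<xi>)"
proof (induction xs)
  case (Cons p xs)
  then show ?case
    by (cases p) (simp add: word_op_Cons words_simps word_lmult_fun_def pi_mult C_act pi_u
        bounded_clinearD(3)[OF pi_bounded])
qed (simp add: word_op_Nil word_lmult_fun_def bounded_clinearD(5)[OF pi_bounded])

lemma W_rmult_fun: "xs \<in> words \<Longrightarrow> k \<in> C \<Longrightarrow> W (word_rmult_fun k xs) \<xi> = W xs (\<pi> k \<xi>)"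
proof (induction xs)
  case (Cons p xs)
  then show ?case
    by (cases p) (simp add: word_op_Cons words_simps word_rmult_fun_def pi_mult)
qed (simp add: word_op_Nil word_rmult_fun_def)

lemma W_lmult_group:
  "xs \<in> words \<Longrightarrow> h \<in> carrier G \<Longrightarrow> W (word_lmult_group h xs) \<xi> = u h (W xs \<xi>)"
proof (induction xs)
  case (Cons p xs)
  then show ?case
    by (cases p) (simp add: word_op_Cons words_simps word_lmult_group_def u_mult
        bounded_clinearD(3)[OF u_bounded])
qed (simp add: word_op_Nil word_lmult_group_def bounded_clinearD(5)[OF u_bounded])

lemma W_rmult_group:
  "xs \<in> words \<Longrightarrow> h \<in> carrier G \<Longrightarrow> W (word_rmult_group h xs) \<xi> = W xs (u h \<xi>)"
proof (induction xs)
  case (Cons p xs)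
  then show ?case
    by (cases p) (simp add: word_op_Cons words_simps word_rmult_group_def u_mult pi_u)
qed (simp add: word_op_Nil word_rmult_group_def)

lemma W_mult: "xs \<in> words \<Longrightarrow> ys \<in> words \<Longrightarrow> W (word_mult xs ys) \<xi> = W xs (W ys \<xi>)"
proof (induction xs)
  case (Cons p xs)
  then show ?case
    by (cases p) (simp add: word_op_Cons words_simps word_mult_def word_op_append W_lmult_group
        W_lmult_fun word_lmult_fun_in)
qed (simp add: word_op_Nil word_mult_def)

text \<open>
  The sum may run over any finite set of group elements containing those of the word; two words
  can then be compared over a common set.
\<close>

lemma W_coeff:
  assumes "xs \<in> words" "finite S" "fst ` set xs \<subseteq> S" "S \<subseteq> carrier G"
  shows "W xs \<xi> = (\<Sum>g\<in>S. u g (\<pi> (coeff xs g) \<xi>))"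
  using assms(1,3)
proof (induction xs)
  case Nil
  have "u g (\<pi> (coeff [] g) \<xi>) = 0" if "g \<in> S" for g
    using that assms(4) by (auto simp: coeff_Nil pi_zero bounded_clinearD(5)[OF u_bounded])
  then show ?case by (simp add: word_op_Nil)
next
  case (Cons p xs)
  obtain h f where p: "p = (h, f)" by fastforce
  with Cons have in': "h \<in> S" "f \<in> C" "xs \<in> words" by (auto simp: words_simps)
  have "u g (\<pi> (coeff (p # xs) g) \<xi>)
      = (if g = h then u h (\<pi> f \<xi>) else 0) + u g (\<pi> (coeff xs g) \<xi>)" if "g \<in> S" for g
    using that assms(4) in'
    by (auto simp: p coeff_Cons pi_add coeff_in bounded_clinearD(3)[OF u_bounded])
  then have "(\<Sum>g\<in>S. u g (\<pi> (coeff (p # xs) g) \<xi>))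
      = u h (\<pi> f \<xi>) + (\<Sum>g\<in>S. u g (\<pi> (coeff xs g) \<xi>))"
    using assms(2) in' by (simp add: sum.distrib)
  with Cons in' show ?case by (simp add: p word_op_Cons)
qed

end

context invariant_algebra
begin

text \<open>
  Integrated forms have the functions on the left of the group elements, words have them on the
  right; covariance moves them across.  The translation is the same for all covariant pairs, which
  keeps norm estimates uniform over them.
\<close>

lemma integrated_form_as_word:
  assumes "F \<in> fin_supp_funs G C_alg"
  shows "\<exists>xs\<in>words. \<forall>\<pi> (u :: _ \<Rightarrow> 'x \<Rightarrow> 'x::complex_hilbert).
    covariant_pair G N H C \<pi> u \<longrightarrow> integrated_form G C_alg \<pi> u F = word_op \<pi> u xs"
proof -
  let ?S = "{g \<in> carrier G. F g \<noteq> azero C_alg}"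
  have F: "F g \<in> C" if "g \<in> carrier G" for g
    using assms that by (simp add: fin_supp_funs_def C_alg_simps)
  have "finite ?S" using assms by (simp add: fin_supp_funs_def)
  from finite_distinct_list[OF this] obtain gs where gs: "set gs = ?S" "distinct gs"
    by (elim exE conjE)
  define xs where "xs = map (\<lambda>g. (g, alpha G N H (inv g) (F g))) gs"
  have "xs \<in> words" using gs(1) by (simp add: xs_def words_def lists_eq_set F C_act image_subset_iff)
  moreover have "integrated_form G C_alg \<pi> u F = word_op \<pi> u xs"
    if "covariant_pair G N H C \<pi> u" for \<pi> and u :: "_ \<Rightarrow> 'x \<Rightarrow> 'x"
  proof
    fix \<xi>
    interpret covariant_pair G N H C \<pi> u by (rule that)
    have "word_op \<pi> u xs \<xi> = (\<Sum>g\<in>?S. u g (\<pi> (alpha G N H (inv g) (F g)) \<xi>))"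
      by (simp add: word_op_def xs_def comp_def sum_list_distinct_conv_sum_set gs)
    also have "\<dots> = integrated_form G C_alg \<pi> u F \<xi>"
      unfolding integrated_form_def by (rule sum.cong) (simp_all add: pi_u F)
    finally show "integrated_form G C_alg \<pi> u F \<xi> = word_op \<pi> u xs \<xi>" ..
  qed
  ultimately show ?thesis by (intro bexI allI impI)
qed

lemma word_as_integrated_form:
  assumes "xs \<in> words"
  shows "\<exists>F\<in>fin_supp_funs G C_alg. \<forall>\<pi> (u :: _ \<Rightarrow> 'x \<Rightarrow> 'x::complex_hilbert).
    covariant_pair G N H C \<pi> u \<longrightarrow> integrated_form G C_alg \<pi> u F = word_op \<pi> u xs"
proof -
  define F where "F g = alpha G N H g (coeff xs g)" for g
  let ?S = "{g \<in> carrier G. F g \<noteq> azero C_alg}"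
  have sub: "?S \<subseteq> fst ` set xs"
  proof (rule subsetI, rule ccontr)
    fix g assume "g \<in> ?S" "g \<notin> fst ` set xs"
    then show False using coeff_eq_zero[of g xs] by (simp add: F_def C_alg_simps act_algebra)
  qed
  have xs: "fst ` set xs \<subseteq> carrier G" using assms by (auto simp: words_def)
  have "F \<in> fin_supp_funs G C_alg"
    using finite_subset[OF sub] assms
    by (simp add: fin_supp_funs_def C_alg_simps F_def C_act coeff_in)
  moreover have "integrated_form G C_alg \<pi> u F = word_op \<pi> u xs"
    if "covariant_pair G N H C \<pi> u" for \<pi> and u :: "_ \<Rightarrow> 'x \<Rightarrow> 'x"
  proof
    fix \<xi>
    interpret covariant_pair G N H C \<pi> u by (rule that)
    have "word_op \<pi> u xs \<xi> = (\<Sum>g\<in>fst ` set xs. u g (\<pi> (coeff xs g) \<xi>))"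
      using assms xs by (intro W_coeff) auto
    also have "\<dots> = (\<Sum>g\<in>fst ` set xs. \<pi> (F g) (u g \<xi>))"
      using xs by (intro sum.cong) (auto simp: F_def u_pi coeff_in[OF assms])
    also have "\<dots> = integrated_form G C_alg \<pi> u F \<xi>"
      unfolding integrated_form_def using sub xs
      by (intro sum.mono_neutral_right) (auto simp: C_alg_simps pi_zero)
    finally show "integrated_form G C_alg \<pi> u F \<xi> = word_op \<pi> u xs \<xi>" ..
  qed
  ultimately show ?thesis by (intro bexI allI impI)
qed

end

section \<open>The regular representation\<close>

definition diag_op :: "('i \<Rightarrow> complex) \<Rightarrow> 'i ell2 \<Rightarrow> 'i ell2"
  where "diag_op \<phi> x = Abs_ell2 (\<lambda>i. \<phi> i * ell2_coord x i)"

definition permute_op :: "('i \<Rightarrow> 'i) \<Rightarrow> 'i ell2 \<Rightarrow> 'i ell2"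
  where "permute_op \<sigma> x = Abs_ell2 (\<lambda>i. ell2_coord x (\<sigma> i))"

definition ell2_basis :: "'i \<Rightarrow> 'i ell2"
  where "ell2_basis j = Abs_ell2 (\<lambda>i. if i = j then 1 else 0)"

lemma ell2_eqI: "(\<And>i. ell2_coord x i = ell2_coord y i) \<Longrightarrow> x = y"
  by (metis ell2_coord_inject ext)

lemma ell2_basis_coord: "ell2_coord (ell2_basis j) i = (if i = j then 1 else 0)"
proof -
  have "(\<lambda>i. (cmod (if i = j then 1 else 0))\<^sup>2) summable_on UNIV \<longleftrightarrow>
    (\<lambda>i. (cmod (if i = j then 1 else 0))\<^sup>2) summable_on {j}"
    by (rule summable_on_cong_neutral) auto
  then show ?thesis by (simp add: ell2_basis_def Abs_ell2_inverse)
qed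

lemma diag_op_summable:
  assumes "\<And>i. cmod (\<phi> i) \<le> K"
  shows "(\<lambda>i. (cmod (\<phi> i * ell2_coord x i))\<^sup>2) summable_on UNIV"
proof (rule summable_on_comparison_test)
  show "(\<lambda>i. K\<^sup>2 * (cmod (ell2_coord x i))\<^sup>2) summable_on UNIV"
    by (intro summable_on_cmult_right ell2_coord_summable)
  show "(cmod (\<phi> i * ell2_coord x i))\<^sup>2 \<le> K\<^sup>2 * (cmod (ell2_coord x i))\<^sup>2" for i
    using power_mono[OF assms, of i 2] by (simp add: norm_mult power_mult_distrib mult_right_mono)
qed simp

lemma diag_op_coord:
  assumes "bounded (range \<phi>)"
  shows "ell2_coord (diag_op \<phi> x) i = \<phi> i * ell2_coord x i"
proof -
  obtain K where "\<And>i. cmod (\<phi> i) \<le> K" using assms by (auto simp: bounded_iff)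
  from diag_op_summable[OF this, where x = x] show ?thesis by (simp add: diag_op_def Abs_ell2_inverse)
qed

lemma diag_op_bounded:
  assumes "bounded (range \<phi>)"
  shows "bounded_clinear (diag_op \<phi>)"
proof -
  obtain K where K: "\<And>i. cmod (\<phi> i) \<le> K" using assms by (auto simp: bounded_iff)
  have "0 \<le> K" using order_trans[OF norm_ge_zero K] .
  note coord = diag_op_coord[OF assms]
  show ?thesis
  proof (rule bounded_clinearI)
    show "norm (diag_op \<phi> x) \<le> K * norm x" for x
    proof (rule power2_le_imp_le)
      have "(norm (diag_op \<phi> x))\<^sup>2 = (\<Sum>\<^sub>\<infinity>i. (cmod (\<phi> i * ell2_coord x i))\<^sup>2)"
        by (simp add: norm_ell2_sq coord)
      also have "\<dots> \<le> (\<Sum>\<^sub>\<infinity>i. K\<^sup>2 * (cmod (ell2_coord x i))\<^sup>2)"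
      proof (rule infsum_mono)
        show "(cmod (\<phi> i * ell2_coord x i))\<^sup>2 \<le> K\<^sup>2 * (cmod (ell2_coord x i))\<^sup>2" for i
          using power_mono[OF K, of i 2] by (simp add: norm_mult power_mult_distrib mult_right_mono)
      qed (intro diag_op_summable[OF K] summable_on_cmult_right ell2_coord_summable)+
      also have "\<dots> = (K * norm x)\<^sup>2"
        by (simp add: infsum_cmult_right' norm_ell2_sq power_mult_distrib)
      finally show "(norm (diag_op \<phi> x))\<^sup>2 \<le> (K * norm x)\<^sup>2" .
    qed (simp add: \<open>0 \<le> K\<close>)
  qed (auto intro!: ell2_eqI simp: coord plus_ell2.rep_eq scaleC_ell2.rep_eq algebra_simps)
qed

lemma diag_op_adjoint:
  assumes "bounded (range \<phi>)"
  shows "is_adjoint (diag_op \<phi>) (diag_op (\<lambda>i. cnj (\<phi> i)))"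
proof -
  have "bounded (range (\<lambda>i. cnj (\<phi> i)))" using assms by (auto simp: bounded_iff)
  then show ?thesis using assms
    by (simp add: is_adjoint_def cinner_ell2.rep_eq diag_op_coord mult.commute mult.left_commute)
qed

lemma permute_op_coord:
  assumes "bij \<sigma>"
  shows "ell2_coord (permute_op \<sigma> x) i = ell2_coord x (\<sigma> i)"
  using summable_on_reindex_bij_betw[OF assms, of "\<lambda>i. (cmod (ell2_coord x i))\<^sup>2"]
    ell2_coord_summable[of x]
  by (simp add: permute_op_def Abs_ell2_inverse)

lemma permute_op_unitary:
  assumes "bij \<sigma>"
  shows "unitary_op (permute_op \<sigma>)"
proof -
  note coord = permute_op_coord[OF assms]
  have inner: "cinner (permute_op \<sigma> x) (permute_op \<sigma> y) = cinner x y" for x y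
    unfolding cinner_ell2.rep_eq coord by (rule infsum_reindex_bij_betw[OF assms])
  have "bounded_clinear (permute_op \<sigma>)"
  proof (rule bounded_clinearI)
    show "norm (permute_op \<sigma> x) \<le> 1 * norm x" for x
      by (simp add: norm_eq_sqrt_inner inner_eq_Re_cinner inner)
  qed (auto intro!: ell2_eqI simp: coord plus_ell2.rep_eq scaleC_ell2.rep_eq)
  moreover have "permute_op \<sigma> (permute_op (inv_into UNIV \<sigma>) x) = x" for x
    by (rule ell2_eqI) (use assms in \<open>simp add: coord permute_op_coord[OF bij_imp_bij_inv]
          bij_is_inj\<close>)
  then have "surj (permute_op \<sigma>)" by (metis surjI)
  ultimately show ?thesis by (simp add: unitary_op_def inner)
qed

lemma ell2_coord_sum: "ell2_coord (\<Sum>k\<in>S. f k) i = (\<Sum>k\<in>S. ell2_coord (f k) i)"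
  by (induction S rule: infinite_finite_induct) (simp_all add: zero_ell2.rep_eq plus_ell2.rep_eq)

text \<open>
  The regular representation lives on \<open>\<ell>\<^sup>2(G)\<close>, but the crossed product is built from
  representations on \<open>\<ell>\<^sup>2\<close> of all pairs of a group type element and a natural number.  Indices
  outside \<open>carrier G\<close> are killed by the functions and fixed by the translations, and the second
  component is carried along.
\<close>

context semidirect
begin

definition regular_fun :: "('g \<Rightarrow> complex) \<Rightarrow> 'g univ_space \<Rightarrow> 'g univ_space"
  where "regular_fun f = diag_op (\<lambda>(h, n). if h \<in> carrier G then f (npart G N H h) else 0)"

definition translation :: "'g \<Rightarrow> 'g \<times> nat \<Rightarrow> 'g \<times> nat"
  where "translation g = (\<lambda>(h, n). (if h \<in> carrier G then inv g \<otimes> h else h, n))"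

definition regular_group :: "'g \<Rightarrow> 'g univ_space \<Rightarrow> 'g univ_space"
  where "regular_group g = permute_op (translation g)"

lemma translation_mult:
  "g \<in> carrier G \<Longrightarrow> h \<in> carrier G \<Longrightarrow> translation (g \<otimes> h) p = translation h (translation g p)"
  by (cases p) (simp add: translation_def inv_mult_group m_assoc)

lemma translation_bij:
  assumes "g \<in> carrier G"
  shows "bij (translation g)"
proof -
  have "translation \<one> p = p" for p by (cases p) (simp add: translation_def)
  then have "translation (inv g) (translation g p) = p" "translation g (translation (inv g) p) = p" for p
    using assms by (simp_all flip: translation_mult)
  then show ?thesis by (metis bijI')
qed

lemma regular_fun_coord:
  assumes "bounded (range f)"
  shows "ell2_coord (regular_fun f x) (h, n) =
    (if h \<in> carrier G then f (npart G N H h) * ell2_coord x (h, n) else 0)"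
proof -
  have "bounded (range (\<lambda>(h, n::nat). if h \<in> carrier G then f (npart G N H h) else 0))"
    by (rule bounded_subset[of "insert 0 (range f)"]) (use assms in auto)
  then show ?thesis by (simp add: regular_fun_def diag_op_coord)
qed

lemma regular_fun_bounded:
  assumes "bounded (range f)"
  shows "bounded_clinear (regular_fun f)" "is_adjoint (regular_fun f) (regular_fun (\<lambda>y. cnj (f y)))"
proof -
  let ?\<phi> = "\<lambda>(h, n::nat). if h \<in> carrier G then f (npart G N H h) else 0"
  have b: "bounded (range ?\<phi>)"
    by (rule bounded_subset[of "insert 0 (range f)"]) (use assms in auto)
  then show "bounded_clinear (regular_fun f)" unfolding regular_fun_def by (rule diag_op_bounded)
  have "(\<lambda>p. cnj (?\<phi> p)) = (\<lambda>(h, n). if h \<in> carrier G then cnj (f (npart G N H h)) else 0)"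
    by auto
  with diag_op_adjoint[OF b]
  show "is_adjoint (regular_fun f) (regular_fun (\<lambda>y. cnj (f y)))" by (simp add: regular_fun_def)
qed

lemma regular_group_coord:
  "g \<in> carrier G \<Longrightarrow> ell2_coord (regular_group g x) p = ell2_coord x (translation g p)"
  by (simp add: regular_group_def permute_op_coord translation_bij)

end

context invariant_algebra
begin

text \<open>
  Covariance is the equivariance of \<open>npart\<close>: conjugating multiplication by \<open>f \<circ> npart\<close> with the
  translation by \<open>g\<close> gives multiplication by \<open>h \<mapsto> f(npart (g\<^sup>-\<^sup>1 h)) = (\<alpha>\<^sub>g f)(npart h)\<close>.
\<close>

lemma regular_covariant: "covariant_pair G N H C regular_fun regular_group"
proof unfold_locales
  note coord = regular_fun_coord[OF C_bounded]
  have "representation C_alg regular_fun"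
    unfolding representation_def C_alg_simps
  proof (intro conjI ballI allI)
    fix f assume f: "f \<in> C"
    show "bounded_clinear (regular_fun f)" "is_adjoint (regular_fun f) (regular_fun (\<lambda>y. cnj (f y)))"
      using f by (simp_all add: regular_fun_bounded C_bounded)
    show "regular_fun (\<lambda>y. c * f y) = (\<lambda>\<xi>. c *\<^sub>C regular_fun f \<xi>)" for c
      using f by (auto intro!: ext ell2_eqI simp: coord C_scale scaleC_ell2.rep_eq)
    fix k assume k: "k \<in> C"
    show "regular_fun (\<lambda>y. f y + k y) = (\<lambda>\<xi>. regular_fun f \<xi> + regular_fun k \<xi>)"
      using f k by (auto intro!: ext ell2_eqI simp: coord C_add plus_ell2.rep_eq distrib_right)
    show "regular_fun (\<lambda>y. f y * k y) = regular_fun f \<circ> regular_fun k"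
      using f k by (auto intro!: ext ell2_eqI simp: coord C_mult)
  qed
  moreover have unitary: "unitary_representation G regular_group"
    unfolding unitary_representation_def
    by (auto intro!: ext ell2_eqI permute_op_unitary translation_bij
        simp: regular_group_coord translation_mult)
      (simp_all add: regular_group_def permute_op_unitary translation_bij)
  moreover have "regular_group g \<circ> regular_fun f \<circ> cadjoint (regular_group g)
      = regular_fun (alpha G N H g f)" if g: "g \<in> carrier G" and f: "f \<in> C" for g f
  proof (rule ext, rule ell2_eqI, clarify)
    fix x :: "'g univ_space" and h :: 'g and n :: nat
    have "translation (inv g) (translation g (h, n)) = (h, n)"
      using g by (cases "h \<in> carrier G") (simp_all add: translation_def flip: m_assoc)
    moreover have "cadjoint (regular_group g) = regular_group (inv g)"
      by (rule cadjoint_eq[OF unitary_representation_adjoint[OF unitary g]])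
    moreover have "alpha G N H g f (npart G N H h) = f (npart G N H (inv g \<otimes> h))" if "h \<in> carrier G"
      using g that by (simp add: alpha_def decomposition beta_npart)
    ultimately show "ell2_coord ((regular_group g \<circ> regular_fun f \<circ> cadjoint (regular_group g)) x) (h, n)
        = ell2_coord (regular_fun (alpha G N H g f) x) (h, n)"
      using g by (auto simp: regular_group_coord coord f C_act translation_def)
  qed
  ultimately show "covariant_representation G N H C_alg regular_fun regular_group"
    by (simp add: covariant_representation_def C_alg_simps)
qed

text \<open>
  Different group elements move the basis vector at \<open>h\<close> to different basis vectors, so the
  coordinate at \<open>g h\<close> isolates the coefficient of \<open>g\<close>.
\<close>

lemma regular_word_coord:
  assumes xs: "xs \<in> words" and g: "g \<in> carrier G" and h: "h \<in> carrier G"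
  shows "ell2_coord (word_op regular_fun regular_group xs (ell2_basis (h, 0))) (g \<otimes> h, 0)
    = coeff xs g (npart G N H h)"
proof -
  interpret covariant_pair G N H C regular_fun regular_group by (rule regular_covariant)
  let ?S = "insert g (fst ` set xs)"
  have S: "?S \<subseteq> carrier G" using xs g by (auto simp: words_def)
  have "W xs (ell2_basis (h, 0)) = (\<Sum>k\<in>?S. regular_group k (regular_fun (coeff xs k) (ell2_basis (h, 0))))"
    using xs S by (intro W_coeff) auto
  moreover have "ell2_coord (regular_group k (regular_fun (coeff xs k) (ell2_basis (h, 0)))) (g \<otimes> h, 0)
      = (if k = g then coeff xs g (npart G N H h) else 0)" if "k \<in> ?S" for k
  proof -
    have k: "k \<in> carrier G" using that S by auto
    have "inv k \<otimes> (g \<otimes> h) = h \<longleftrightarrow> k = g"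
    proof
      assume "inv k \<otimes> (g \<otimes> h) = h"
      then have "k \<otimes> h = g \<otimes> h" using k g h inv_solve_left' by force
      then show "k = g" using k g h by simp
    qed (use g h in \<open>simp add: m_assoc[symmetric]\<close>)
    then show ?thesis using k g h
      by (auto simp: regular_group_coord translation_def ell2_basis_coord
          regular_fun_coord[OF C_bounded[OF coeff_in[OF xs]]])
  qed
  ultimately show ?thesis by (simp add: ell2_coord_sum)
qed

end

section \<open>The algebras generated by indicators of cosets\<close>

locale normal_conjugates = semidirect G N H
  for G :: "('g, 'm) monoid_scheme" (structure) and N H :: "'g set" +
  fixes M :: "'g set"
  assumes M_normal: "M \<lhd> G\<lparr>carrier := N\<rparr>"
    and filter_base: "is_filter_base (conjugates G H M)"
    and finite_quotients: "has_finite_quotients G (conjugates G H M)"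
begin

abbreviation "D0 \<equiv> carrier (D0_alg G N H M)"
abbreviation "D \<equiv> carrier (D_alg G N H M)"

lemma conjugates_eq: "conjugates G H M = {(\<lambda>m. a \<otimes> m \<otimes> inv a) ` M | a. a \<in> H}"
  unfolding conjugates_def l_coset_def r_coset_def by (auto simp: image_def)

lemma M_subgroup: "subgroup M G" and M_sub_N: "M \<subseteq> N"
proof -
  have "subgroup M (G\<lparr>carrier := N\<rparr>)" by (rule normal_imp_subgroup[OF M_normal])
  then show "subgroup M G" "M \<subseteq> N"
    using incl_subgroup[OF N_subgroup] subgroup.subset by force+
qed

lemma conj_subgroup:
  assumes "subgroup K G" "a \<in> carrier G"
  shows "subgroup ((\<lambda>m. a \<otimes> m \<otimes> inv a) ` K) G"
proof (rule subgroupI)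
  have K: "m \<in> carrier G" if "m \<in> K" for m using that assms(1) by (rule subgroup.mem_carrier[rotated])
  show "(\<lambda>m. a \<otimes> m \<otimes> inv a) ` K \<subseteq> carrier G" using assms(2) K by auto
  show "(\<lambda>m. a \<otimes> m \<otimes> inv a) ` K \<noteq> {}" using subgroup.one_closed[OF assms(1)] by auto
  fix b assume "b \<in> (\<lambda>m. a \<otimes> m \<otimes> inv a) ` K"
  then obtain m where m: "m \<in> K" "b = a \<otimes> m \<otimes> inv a" by auto
  have "inv b = a \<otimes> inv m \<otimes> inv a" using m assms(2) K by (simp add: inv_mult_group m_assoc)
  then show "inv b \<in> (\<lambda>m. a \<otimes> m \<otimes> inv a) ` K"
    using subgroup.m_inv_closed[OF assms(1) m(1)] by auto
  fix c assume "c \<in> (\<lambda>m. a \<otimes> m \<otimes> inv a) ` K"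
  then obtain k where k: "k \<in> K" "c = a \<otimes> k \<otimes> inv a" by auto
  have "a \<otimes> m \<otimes> inv a \<otimes> (a \<otimes> k \<otimes> inv a) = a \<otimes> m \<otimes> (inv a \<otimes> a) \<otimes> k \<otimes> inv a"
    using m k K assms(2) by (simp only: m_assoc m_closed inv_closed)
  then have "b \<otimes> c = a \<otimes> (m \<otimes> k) \<otimes> inv a"
    using m k K assms(2) by (simp add: m_assoc)
  then show "b \<otimes> c \<in> (\<lambda>m. a \<otimes> m \<otimes> inv a) ` K"
    using subgroup.m_closed[OF assms(1) m(1) k(1)] by auto
qed

lemma conjugate_subgroup:
  assumes "U \<in> conjugates G H M"
  shows "subgroup U G" "U \<subseteq> N"
proof -
  obtain a where a: "a \<in> H" "U = (\<lambda>m. a \<otimes> m \<otimes> inv a) ` M" using assms conjugates_eq by auto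
  then show "subgroup U G" using conj_subgroup[OF M_subgroup] H_carrier by simp
  show "U \<subseteq> N" using a M_sub_N N_conj H_carrier by auto
qed

lemma conj_conjugate:
  assumes "U \<in> conjugates G H M" "b \<in> H"
  shows "(\<lambda>m. b \<otimes> m \<otimes> inv b) ` U \<in> conjugates G H M"
proof -
  obtain a where a: "a \<in> H" "U = (\<lambda>m. a \<otimes> m \<otimes> inv a) ` M" using assms conjugates_eq by auto
  have "b \<otimes> (a \<otimes> m \<otimes> inv a) \<otimes> inv b = (b \<otimes> a) \<otimes> m \<otimes> inv (b \<otimes> a)" if "m \<in> M" for m
    using that M_sub_N N_carrier H_carrier a(1) assms(2) by (simp add: subset_iff inv_mult_group m_assoc)
  then have "(\<lambda>m. b \<otimes> m \<otimes> inv b) ` U = (\<lambda>m. (b \<otimes> a) \<otimes> m \<otimes> inv (b \<otimes> a)) ` M"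
    unfolding a(2) image_image by (rule image_cong[OF refl])
  then show ?thesis using H_closed(1)[OF assms(2) a(1)] conjugates_eq by auto
qed

lemma coset_sub_N: "x \<in> N \<Longrightarrow> U \<in> conjugates G H M \<Longrightarrow> x <# U \<subseteq> N"
  using conjugate_subgroup(2) N_closed(1) by (auto simp: l_coset_def)

lemma linf_simps: "azero (linf N) = (\<lambda>_. 0)" "aadd (linf N) f k = (\<lambda>y. f y + k y)"
  "ascale (linf N) c f = (\<lambda>y. c * f y)" "amult (linf N) f k = (\<lambda>y. f y * k y)"
  "astar (linf N) f = (\<lambda>y. cnj (f y))"
  by (simp_all add: linf_def)

lemma linf_iff:
  "f \<in> carrier (linf N) \<longleftrightarrow> (\<forall>y. y \<notin> N \<longrightarrow> f y = 0) \<and> (\<exists>K. \<forall>y. cmod (f y) \<le> K)"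
  by (auto simp: linf_def bounded_iff)

lemma coset_funs_linf: "coset_funs G N H M \<subseteq> carrier (linf N)"
proof
  fix f assume "f \<in> coset_funs G N H M"
  then obtain x U where f: "f = indicator (x <# U)" "x \<in> N" "U \<in> conjugates G H M"
    by (auto simp: coset_funs_def)
  have "cmod (f y) \<le> 1" for y by (simp add: f(1) indicator_def)
  then show "f \<in> carrier (linf N)"
    using coset_sub_N[OF f(2,3)] by (auto simp: linf_iff f(1) indicator_def)
qed

lemma linf_closed: "linf_closed_star_subalgebra N (carrier (linf N))"
  unfolding linf_closed_star_subalgebra_def
proof (intro conjI ballI allI impI)
  show "azero (linf N) \<in> carrier (linf N)" by (auto simp: linf_iff linf_simps)
  fix f assume f: "f \<in> carrier (linf N)"
  then obtain K where K: "\<And>y. cmod (f y) \<le> K" by (auto simp: linf_iff)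
  have "cmod (c * f y) \<le> cmod c * K" for c y
    using K by (simp add: norm_mult mult_left_mono)
  then show "ascale (linf N) c f \<in> carrier (linf N)" for c
    using f unfolding linf_iff linf_simps by auto
  show "astar (linf N) f \<in> carrier (linf N)" using f unfolding linf_iff linf_simps by auto
  fix k assume k: "k \<in> carrier (linf N)"
  then obtain L where L: "\<And>y. cmod (k y) \<le> L" by (auto simp: linf_iff)
  have "cmod (f y + k y) \<le> K + L" for y by (rule norm_triangle_mono[OF K L])
  then show "aadd (linf N) f k \<in> carrier (linf N)"
    using f k unfolding linf_iff linf_simps by auto
  have "0 \<le> K" using order_trans[OF norm_ge_zero K] .
  then have "cmod (f y * k y) \<le> K * L" for y
    unfolding norm_mult by (intro mult_mono K L) auto
  then show "amult (linf N) f k \<in> carrier (linf N)"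
    using f k unfolding linf_iff linf_simps by auto
qed simp

lemma act_linf:
  assumes "f \<in> carrier (linf N)"
  shows "act g f \<in> carrier (linf N)"
proof -
  obtain K where "\<And>y. cmod (f y) \<le> K" using assms by (auto simp: linf_iff)
  then have "cmod (act g f y) \<le> max K 0" for y by (auto simp: alpha_def le_max_iff_disj)
  then show ?thesis by (auto simp: linf_iff act_outside)
qed

text \<open>
  \<open>\<beta>\<^sub>g (x U) = \<beta>\<^sub>g(x) (a U a\<^sup>-\<^sup>1)\<close>, where \<open>a\<close> is the component of \<open>g\<close> in \<open>H\<close>, is again a coset of
  a conjugate of \<open>M\<close>.
\<close>

lemma act_coset_funs:
  assumes "f \<in> coset_funs G N H M" "g \<in> carrier G"
  shows "act g f \<in> coset_funs G N H M"
proof -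
  obtain x U where f: "f = indicator (x <# U)" and x: "x \<in> N" and U: "U \<in> conjugates G H M"
    using assms(1) by (auto simp: coset_funs_def)
  let ?a = "hpart G N H g" and ?n = "npart G N H g" and ?b = "beta G N H"
  let ?V = "(\<lambda>m. ?a \<otimes> m \<otimes> inv ?a) ` U"
  note d = decomposition[OF assms(2)]
  have beta_shift: "?b g (x \<otimes> s) = ?b g x \<otimes> (?a \<otimes> s \<otimes> inv ?a)" if "s \<in> U" for s
  proof -
    have c: "?n \<in> carrier G" "?a \<in> carrier G" "x \<in> carrier G" "s \<in> carrier G"
      using d x that conjugate_subgroup(2)[OF U] N_carrier H_carrier by auto
    have "?a \<otimes> (x \<otimes> s) \<otimes> inv ?a = ?a \<otimes> x \<otimes> (inv ?a \<otimes> ?a) \<otimes> s \<otimes> inv ?a"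
      using c by (simp add: m_assoc)
    also have "\<dots> = ?a \<otimes> x \<otimes> inv ?a \<otimes> (?a \<otimes> s \<otimes> inv ?a)"
      using c by (simp only: m_assoc m_closed inv_closed)
    finally show ?thesis using c by (simp add: beta_def m_assoc)
  qed
  have "?b (inv g) y \<in> x <# U \<longleftrightarrow> y \<in> ?b g x <# ?V" if y: "y \<in> N" for y
  proof
    assume "?b (inv g) y \<in> x <# U"
    then obtain s where "s \<in> U" "?b (inv g) y = x \<otimes> s" by (auto simp: l_coset_def)
    then show "y \<in> ?b g x <# ?V"
      using beta_inv(1)[OF assms(2) y] beta_shift[of s] by (auto simp: l_coset_def)
  next
    assume "y \<in> ?b g x <# ?V"
    then obtain s where s: "s \<in> U" "y = ?b g (x \<otimes> s)"
      using beta_shift by (auto simp: l_coset_def)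
    have "x \<otimes> s \<in> N" using x s conjugate_subgroup(2)[OF U] N_closed(1) by auto
    then show "?b (inv g) y \<in> x <# U" using s beta_inv(2)[OF assms(2)] by (auto simp: l_coset_def)
  qed
  moreover have "?b g x <# ?V \<subseteq> N"
    by (intro coset_sub_N beta_closed assms x conj_conjugate U d)
  ultimately have "act g f = indicator (?b g x <# ?V)"
    by (auto simp: alpha_def f indicator_def fun_eq_iff)
  then show ?thesis
    unfolding coset_funs_def using beta_closed[OF assms(2) x] conj_conjugate[OF U d(2)] by blast
qed

lemma D_iff: "f \<in> D \<longleftrightarrow>
    (\<forall>B. coset_funs G N H M \<subseteq> B \<longrightarrow> linf_closed_star_subalgebra N B \<longrightarrow> f \<in> B)"
  by (auto simp: D_alg_def)

text \<open>
  \<open>D\<close> is an intersection of closed algebras, so invariance is proved by pulling back: if \<open>B\<close> is one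
  of these algebras, then so is its preimage under \<open>\<alpha>\<^sub>g\<close>.
\<close>

lemma D_act:
  assumes "f \<in> D" "g \<in> carrier G"
  shows "act g f \<in> D"
  unfolding D_iff
proof (intro allI impI)
  fix B assume B: "coset_funs G N H M \<subseteq> B" "linf_closed_star_subalgebra N B"
  let ?B = "{f \<in> carrier (linf N). act g f \<in> B}"
  have closed: "(\<lambda>_. 0) \<in> B" "\<And>f k. f \<in> B \<Longrightarrow> k \<in> B \<Longrightarrow> (\<lambda>y. f y + k y) \<in> B"
    "\<And>f k. f \<in> B \<Longrightarrow> k \<in> B \<Longrightarrow> (\<lambda>y. f y * k y) \<in> B"
    "\<And>f c. f \<in> B \<Longrightarrow> (\<lambda>y. c * f y) \<in> B" "\<And>f. f \<in> B \<Longrightarrow> (\<lambda>y. cnj (f y)) \<in> B"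
    "\<And>f. f \<in> carrier (linf N) \<Longrightarrow> (\<And>\<epsilon>. \<epsilon> > 0 \<Longrightarrow> \<exists>h\<in>B. \<forall>y\<in>N. cmod (f y - h y) \<le> \<epsilon>) \<Longrightarrow> f \<in> B"
    using B(2) by (simp_all add: linf_closed_star_subalgebra_def linf_simps)
  have "linf_closed_star_subalgebra N ?B"
    unfolding linf_closed_star_subalgebra_def
  proof (intro conjI ballI allI impI)
    show "azero (linf N) \<in> ?B"
      using linf_closed closed(1)
      by (simp add: linf_closed_star_subalgebra_def linf_simps act_algebra)
    fix f k assume "f \<in> ?B" "k \<in> ?B"
    then show "aadd (linf N) f k \<in> ?B" "amult (linf N) f k \<in> ?B"
      using linf_closed closed(2,3)
      by (simp_all add: linf_closed_star_subalgebra_def linf_simps act_algebra)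
  next
    fix f assume "f \<in> ?B"
    then show "ascale (linf N) c f \<in> ?B" "astar (linf N) f \<in> ?B" for c
      using linf_closed closed(4,5)
      by (simp_all add: linf_closed_star_subalgebra_def linf_simps act_algebra)
  next
    fix f assume f: "f \<in> carrier (linf N)" "\<forall>\<epsilon>>0. \<exists>h\<in>?B. \<forall>y\<in>N. cmod (f y - h y) \<le> \<epsilon>"
    have "act g f \<in> B"
    proof (rule closed(6)[OF act_linf[OF f(1)]])
      fix \<epsilon> :: real assume "\<epsilon> > 0"
      then obtain h where "h \<in> ?B" "\<forall>y\<in>N. cmod (f y - h y) \<le> \<epsilon>" using f(2) by meson
      moreover from this have "\<forall>y\<in>N. cmod (act g f y - act g h y) \<le> \<epsilon>"
        using beta_closed[OF inv_closed[OF assms(2)]] by (simp add: alpha_def)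
      ultimately show "\<exists>h\<in>B. \<forall>y\<in>N. cmod (act g f y - h y) \<le> \<epsilon>" by blast
    qed
    with f(1) show "f \<in> ?B" by simp
  qed simp
  moreover have "coset_funs G N H M \<subseteq> ?B"
    using coset_funs_linf act_coset_funs[OF _ assms(2)] B(1) by blast
  ultimately have "f \<in> ?B" using assms(1) D_iff by blast
  then show "act g f \<in> B" by simp
qed

lemma D_invariant: "invariant_algebra G N H D"
proof unfold_locales
  show "D \<subseteq> carrier (linf N)"
    using D_iff coset_funs_linf linf_closed by blast
  show "(\<lambda>_. 0) \<in> D"
    by (auto simp: D_iff linf_closed_star_subalgebra_def linf_simps)
  fix f assume f: "f \<in> D"
  show "(\<lambda>y. c * f y) \<in> D" "(\<lambda>y. cnj (f y)) \<in> D" for c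
    using f by (auto simp: D_iff linf_closed_star_subalgebra_def linf_simps)
  show "alpha G N H g f \<in> D" if "g \<in> carrier G" for g by (rule D_act[OF f that])
  fix k assume k: "k \<in> D"
  show "(\<lambda>y. f y + k y) \<in> D" "(\<lambda>y. f y * k y) \<in> D"
    using f k by (auto simp: D_iff linf_closed_star_subalgebra_def linf_simps)
qed

lemma D0_span: "D0 = alg_span (linf N) (coset_funs G N H M)"
  by (simp add: D0_alg_def)

lemma D0_intros:
  "f \<in> coset_funs G N H M \<Longrightarrow> f \<in> D0" "(\<lambda>_. 0) \<in> D0"
  "f \<in> D0 \<Longrightarrow> k \<in> D0 \<Longrightarrow> (\<lambda>y. f y + k y) \<in> D0" "f \<in> D0 \<Longrightarrow> (\<lambda>y. c * f y) \<in> D0"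
  using alg_span.intros[where B = "linf N" and S = "coset_funs G N H M"] by (auto simp: D0_span linf_simps)

lemma D0_induct [consumes 1, case_names zero coset add scale]:
  assumes "f \<in> D0" "P (\<lambda>_. 0)" "\<And>f. f \<in> coset_funs G N H M \<Longrightarrow> P f"
    "\<And>f k. f \<in> D0 \<Longrightarrow> P f \<Longrightarrow> k \<in> D0 \<Longrightarrow> P k \<Longrightarrow> P (\<lambda>y. f y + k y)"
    "\<And>f c. f \<in> D0 \<Longrightarrow> P f \<Longrightarrow> P (\<lambda>y. c * f y)"
  shows "P f"
  using assms(1) unfolding D0_span
proof (induction rule: alg_span.induct)
  case zero
  then show ?case using assms(2) by (simp add: linf_simps)
next
  case (base s)
  then show ?case by (rule assms(3))
next
  case (add a b)
  then show ?case using assms(4)[of a b] by (simp add: linf_simps D0_span)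
next
  case (scale a c)
  then show ?case using assms(5)[of a c] by (simp add: linf_simps D0_span)
qed

lemma D0_sub_D: "D0 \<subseteq> D"
proof
  fix f assume "f \<in> D0"
  then show "f \<in> D"
  proof (induction rule: D0_induct)
    case (coset f)
    then show ?case by (auto simp: D_iff)
  qed (auto intro: invariant_algebra.C_zero[OF D_invariant] invariant_algebra.C_add[OF D_invariant]
      invariant_algebra.C_scale[OF D_invariant])
qed

lemma indicator_disjoint_Union_D0:
  assumes "finite \<F>" "disjoint \<F>" "\<And>A. A \<in> \<F> \<Longrightarrow> indicator A \<in> D0"
  shows "indicator (\<Union>\<F>) \<in> D0"
  using assms
proof (induction \<F> rule: finite_induct)
  case empty
  then show ?case using D0_intros(2) by (simp add: indicator_def)
next
  case (insert A \<F>)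
  have "A \<inter> \<Union>\<F> = {}" using insert.prems(1) insert.hyps(2) by (auto simp: pairwise_insert disjnt_def)
  then have "indicator (\<Union>(insert A \<F>)) = (\<lambda>y. indicator A y + indicator (\<Union>\<F>) y :: complex)"
    by (auto simp: indicator_def fun_eq_iff)
  moreover have "disjoint \<F>" using insert.prems(1) by (simp add: pairwise_insert)
  ultimately show ?case using insert D0_intros(3) by simp
qed

text \<open>
  Choose \<open>W \<subseteq> U \<inter> V\<close> in the filter base.  The set \<open>x U \<inter> y V\<close> is a union of cosets of \<open>W\<close>,
  finitely many because \<open>U/W\<close> is finite.
\<close>

lemma coset_funs_mult:
  assumes "f \<in> coset_funs G N H M" "k \<in> coset_funs G N H M"
  shows "(\<lambda>p. f p * k p) \<in> D0"
proof -
  obtain x U y V where f: "f = indicator (x <# U)" "x \<in> N" "U \<in> conjugates G H M"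
    and k: "k = indicator (y <# V)" "y \<in> N" "V \<in> conjugates G H M"
    using assms by (auto simp: coset_funs_def)
  obtain W where W: "W \<in> conjugates G H M" "W \<subseteq> U" "W \<subseteq> V"
    using filter_base f(3) k(3) unfolding is_filter_base_def by (meson Int_subset_iff)
  note sub = conjugate_subgroup(1)[OF f(3)] conjugate_subgroup(1)[OF k(3)] conjugate_subgroup(1)[OF W(1)]
  have UG: "U \<subseteq> carrier G" and WG: "W \<subseteq> carrier G" and xG: "x \<in> carrier G" and yG: "y \<in> carrier G"
    using sub f(2) k(2) N_carrier by (auto simp: subgroup.subset)
  let ?I = "(x <# U) \<inter> (y <# V)"
  let ?\<F> = "(\<lambda>p. p <# W) ` ?I"
  have IN: "?I \<subseteq> N" using coset_sub_N[OF f(2,3)] by blast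
  have self: "p \<in> p <# W" if "p \<in> N" for p
    using that subgroup.one_closed[OF sub(3)] N_carrier by (force simp: l_coset_def)
  have "\<Union>?\<F> = ?I"
  proof
    show "?I \<subseteq> \<Union>?\<F>" using self IN by auto
    show "\<Union>?\<F> \<subseteq> ?I"
    proof clarify
      fix q p assume p: "p \<in> x <# U" "p \<in> y <# V" and q: "q \<in> p <# W"
      have "p <# U = x <# U" "p <# V = y <# V"
        using l_repr_independence[OF p(1) xG sub(1)] l_repr_independence[OF p(2) yG sub(2)] by simp_all
      moreover have "q \<in> p <# U" "q \<in> p <# V" using q W by (auto simp: l_coset_def)
      ultimately show "q \<in> ?I" by simp
    qed
  qed
  moreover have "disjoint ?\<F>"
  proof (rule pairwiseI)
    fix A B assume "A \<in> ?\<F>" "B \<in> ?\<F>" "A \<noteq> B"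
    then obtain p q where A: "A = p <# W" "p \<in> N" and B: "B = q <# W" "q \<in> N"
      using IN by auto
    show "disjnt A B"
    proof (rule ccontr)
      assume "\<not> disjnt A B"
      then obtain r where "r \<in> A" "r \<in> B" by (auto simp: disjnt_def)
      then have "A = B"
        using l_repr_independence[of r p W] l_repr_independence[of r q W] A B sub(3) N_carrier by simp
      with \<open>A \<noteq> B\<close> show False ..
    qed
  qed
  moreover have "finite ?\<F>"
  proof -
    have "finite (carrier (G\<lparr>carrier := U\<rparr> Mod W))"
      using finite_quotients f(3) W by (auto simp: has_finite_quotients_def)
    then have fin: "finite ((\<lambda>s. W #> s) ` U)"
      by (rule rev_finite_subset) (auto simp: FactGroup_def RCOSETS_def r_coset_def)
    have "s <# W = m_inv G ` (W #> inv s)" if "s \<in> U" for s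
    proof -
      have s: "s \<in> carrier G" using that UG by auto
      have inv: "inv (w \<otimes> inv s) = s \<otimes> inv w" if "w \<in> W" for w
        using that WG s by (auto simp: inv_mult_group)
      have "W = m_inv G ` W"
        using subgroup.m_inv_closed[OF sub(3)] WG by (force simp: image_iff)
      then have "s <# W = (\<lambda>w. s \<otimes> w) ` m_inv G ` W" by (auto simp: l_coset_def)
      also have "\<dots> = m_inv G ` (\<lambda>w. w \<otimes> inv s) ` W"
        unfolding image_image using inv by (intro image_cong) auto
      also have "(\<lambda>w. w \<otimes> inv s) ` W = W #> inv s" by (auto simp: r_coset_def)
      finally show ?thesis .
    qed
    then have "(\<lambda>s. s <# W) ` U \<subseteq> (\<lambda>A. m_inv G ` A) ` (\<lambda>s. W #> s) ` U"
      using subgroup.m_inv_closed[OF sub(1)] by blast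
    then have "finite ((\<lambda>A. x <# A) ` (\<lambda>s. s <# W) ` U)"
      using fin finite_subset by blast
    moreover have "?\<F> \<subseteq> (\<lambda>A. x <# A) ` (\<lambda>s. s <# W) ` U"
    proof clarify
      fix p assume "p \<in> x <# U"
      then obtain s where s: "s \<in> U" "p = x \<otimes> s" by (auto simp: l_coset_def)
      then have "p <# W = x <# (s <# W)" using lcos_m_assoc[OF WG xG] UG by auto
      with s show "p <# W \<in> (\<lambda>A. x <# A) ` (\<lambda>s. s <# W) ` U" by blast
    qed
    ultimately show ?thesis by (rule rev_finite_subset)
  qed
  moreover have "indicator A \<in> D0" if "A \<in> ?\<F>" for A
    using that IN W(1) by (intro D0_intros(1)) (auto simp: coset_funs_def)
  ultimately have "indicator ?I \<in> D0"
    using indicator_disjoint_Union_D0[of ?\<F>] by simp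
  moreover have "(\<lambda>p. f p * k p) = indicator ?I"
    by (auto simp: f k indicator_def fun_eq_iff)
  ultimately show ?thesis by simp
qed

lemma D0_mult:
  assumes "f \<in> D0" "k \<in> D0"
  shows "(\<lambda>y. f y * k y) \<in> D0"
  using assms(1)
proof (induction rule: D0_induct)
  case (coset f)
  show ?case using assms(2)
  proof (induction rule: D0_induct)
    case (coset k)
    then show ?case using \<open>f \<in> coset_funs G N H M\<close> by (intro coset_funs_mult)
  next
    case (scale k c)
    then show ?case using D0_intros(4)[of "\<lambda>y. f y * k y" c] by (simp add: ac_simps)
  qed (use D0_intros in \<open>simp_all add: distrib_left\<close>)
next
  case (scale f c)
  then show ?case using D0_intros(4)[of "\<lambda>y. f y * k y" c] by (simp add: ac_simps)
qed (use D0_intros in \<open>simp_all add: distrib_right\<close>)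

lemma D0_invariant: "invariant_algebra G N H D0"
proof unfold_locales
  show "D0 \<subseteq> carrier (linf N)"
    using D0_sub_D invariant_algebra.C_linf[OF D_invariant] by blast
  show "(\<lambda>_. 0) \<in> D0" by (rule D0_intros)
  fix f assume f: "f \<in> D0"
  show "(\<lambda>y. c * f y) \<in> D0" for c using f by (rule D0_intros)
  show "(\<lambda>y. cnj (f y)) \<in> D0" using f
  proof (induction rule: D0_induct)
    case (coset f)
    then have "(\<lambda>y. cnj (f y)) = f" by (auto simp: coset_funs_def indicator_def)
    with coset show ?case by (simp add: D0_intros)
  qed (simp_all add: D0_intros)
  show "alpha G N H g f \<in> D0" if g: "g \<in> carrier G" for g using f
  proof (induction rule: D0_induct)
    case (coset f)
    then show ?case by (intro D0_intros(1) act_coset_funs g)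
  qed (simp_all add: D0_intros act_algebra)
  fix k assume k: "k \<in> D0"
  show "(\<lambda>y. f y + k y) \<in> D0" "(\<lambda>y. f y * k y) \<in> D0"
    using f k by (rule D0_intros, rule D0_mult)
qed

end

sublocale normal_conjugates \<subseteq> D: invariant_algebra G N H "carrier (D_alg G N H M)"
  by (rule D_invariant)

sublocale normal_conjugates \<subseteq> D0: invariant_algebra G N H "carrier (D0_alg G N H M)"
  by (rule D0_invariant)

context normal_conjugates
begin

lemma C_alg_D: "D.C_alg = D_alg G N H M" and C_alg_D0: "D0.C_alg = D0_alg G N H M"
  unfolding D.C_alg_def D0.C_alg_def by (simp_all add: D_alg_def D0_alg_def)

end

section \<open>The crossed product and its multipliers\<close>

lemma multiplier_algebra_simps:
  "aadd (multiplier_algebra A) (L, R) (L', R')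
    = ((\<lambda>a\<in>carrier A. aadd A (L a) (L' a)), (\<lambda>a\<in>carrier A. aadd A (R a) (R' a)))"
  "ascale (multiplier_algebra A) c (L, R)
    = ((\<lambda>a\<in>carrier A. ascale A c (L a)), (\<lambda>a\<in>carrier A. ascale A c (R a)))"
  "amult (multiplier_algebra A) (L, R) (L', R') = (compose (carrier A) L L', compose (carrier A) R' R)"
  "astar (multiplier_algebra A) (L, R)
    = ((\<lambda>a\<in>carrier A. astar A (R (astar A a))), (\<lambda>a\<in>carrier A. astar A (L (astar A a))))"
  "azero (multiplier_algebra A) = ((\<lambda>a\<in>carrier A. azero A), (\<lambda>a\<in>carrier A. azero A))"
  by (simp_all add: multiplier_algebra_def)

context normal_conjugates
begin

\<comment> \<open>Covariant representations \<open>\<rho> = (\<pi>, u)\<close> are handled as single indices.\<close>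
declare split_paired_All [simp del]

abbreviation "CP \<equiv> crossed_product G N H M"
abbreviation "reps \<equiv> cov_reps G N H M"
abbreviation "rep_word \<rho> \<equiv> word_op (fst \<rho>) (snd \<rho>)"

lemma covariant_pair_D0I:
  assumes "covariant_representation G N H (D0_alg G N H M) \<pi> u"
  shows "covariant_pair G N H D0 \<pi> u"
  using assms by unfold_locales (simp add: C_alg_D0)

lemma reps_D: "\<rho> \<in> reps \<Longrightarrow> covariant_pair G N H D (fst \<rho>) (snd \<rho>)"
  by unfold_locales (auto simp: C_alg_D cov_reps_def)

lemma reps_D0:
  assumes "\<rho> \<in> reps"
  shows "covariant_pair G N H D0 (fst \<rho>) (snd \<rho>)"
proof (rule covariant_pair_D0I)
  have same: "aadd (D0_alg G N H M) = aadd (D_alg G N H M)"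
    "ascale (D0_alg G N H M) = ascale (D_alg G N H M)"
    "amult (D0_alg G N H M) = amult (D_alg G N H M)"
    "astar (D0_alg G N H M) = astar (D_alg G N H M)"
    by (simp_all add: D_alg_def D0_alg_def)
  have cov: "representation (D_alg G N H M) (fst \<rho>)" "unitary_representation G (snd \<rho>)"
    "\<forall>g\<in>carrier G. \<forall>f\<in>D. snd \<rho> g \<circ> fst \<rho> f \<circ> cadjoint (snd \<rho> g) = fst \<rho> (act g f)"
    using assms by (auto simp: cov_reps_def covariant_representation_def)
  have "representation (D0_alg G N H M) (fst \<rho>)"
    using cov(1) D0_sub_D unfolding representation_def same by (meson subsetD)
  then show "covariant_representation G N H (D0_alg G N H M) (fst \<rho>) (snd \<rho>)"
    using cov(2,3) D0_sub_D unfolding covariant_representation_def by (meson subsetD)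
qed

lemma regular_in_reps: "(regular_fun, regular_group) \<in> reps"
  using covariant_pair.covariant[OF D.regular_covariant] by (simp add: cov_reps_def C_alg_D)

lemma CP_simps: "azero CP = (\<lambda>_ _. 0)" "aadd CP s t = (\<lambda>\<rho> \<xi>. s \<rho> \<xi> + t \<rho> \<xi>)"
  "ascale CP c t = (\<lambda>\<rho> \<xi>. c *\<^sub>C t \<rho> \<xi>)" "amult CP s t = (\<lambda>\<rho> \<xi>. s \<rho> (t \<rho> \<xi>))"
  "astar CP t = (\<lambda>\<rho>. cadjoint (t \<rho>))"
  by (simp_all add: crossed_product_def comp_def)

text \<open>
  \<open>T \<rho> = 0\<close> at indices that are not covariant representations is the normalisation used in
  \<^const>\<open>crossed_product\<close>.
\<close>

definition family :: "'g univ_family \<Rightarrow> bool"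
  where "family t \<longleftrightarrow> (\<forall>\<rho>\<in>reps. bounded_clinear (t \<rho>)) \<and> (\<forall>\<rho>. \<rho> \<notin> reps \<longrightarrow> t \<rho> = (\<lambda>_. 0))"

lemma familyD: "family t \<Longrightarrow> bounded_clinear (t \<rho>)"
  by (cases "\<rho> \<in> reps") (simp_all add: family_def bounded_clinear_zero)

text \<open>
  In terms of words and pointwise norm bounds, membership in the crossed product becomes stable
  under the word operations.
\<close>

lemma CP_iff: "T \<in> carrier CP \<longleftrightarrow> family T \<and>
    (\<forall>\<epsilon>>0. \<exists>xs\<in>D.words. \<forall>\<rho>\<in>reps. \<forall>\<xi>. norm (T \<rho> \<xi> - rep_word \<rho> xs \<xi>) \<le> \<epsilon> * norm \<xi>)"
proof -
  have "(\<exists>F\<in>fin_supp_funs G (D_alg G N H M). \<forall>(\<pi>, u)\<in>reps.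
          onorm (\<lambda>\<xi>. T (\<pi>, u) \<xi> - integrated_form G (D_alg G N H M) \<pi> u F \<xi>) \<le> \<epsilon>)
      \<longleftrightarrow> (\<exists>xs\<in>D.words. \<forall>\<rho>\<in>reps. \<forall>\<xi>. norm (T \<rho> \<xi> - rep_word \<rho> xs \<xi>) \<le> \<epsilon> * norm \<xi>)"
    (is "?L \<longleftrightarrow> ?R") if T: "family T" and \<epsilon>: "\<epsilon> > 0" for \<epsilon>
  proof -
    have onorm_iff: "onorm (\<lambda>\<xi>. T \<rho> \<xi> - rep_word \<rho> xs \<xi>) \<le> \<epsilon>
        \<longleftrightarrow> (\<forall>\<xi>. norm (T \<rho> \<xi> - rep_word \<rho> xs \<xi>) \<le> \<epsilon> * norm \<xi>)"
      if "\<rho> \<in> reps" "xs \<in> D.words" for \<rho> xs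
      using onorm_le_iff[OF bounded_clinear_minus[OF familyD[OF T]
            covariant_pair.W_bounded[OF reps_D]], OF that, of \<epsilon> \<rho>] \<epsilon> by simp
    show ?thesis
    proof
      assume ?L
      then obtain F where F: "F \<in> fin_supp_funs G D.C_alg" "\<forall>(\<pi>, u)\<in>reps.
          onorm (\<lambda>\<xi>. T (\<pi>, u) \<xi> - integrated_form G D.C_alg \<pi> u F \<xi>) \<le> \<epsilon>"
        unfolding C_alg_D by (elim bexE)
      obtain xs where xs: "xs \<in> D.words" "\<forall>\<pi> (u :: 'g \<Rightarrow> 'g univ_space \<Rightarrow> 'g univ_space).
          covariant_pair G N H D \<pi> u \<longrightarrow> integrated_form G D.C_alg \<pi> u F = word_op \<pi> u xs"
        using D.integrated_form_as_word[OF F(1)] by (elim bexE)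
      have "onorm (\<lambda>\<xi>. T \<rho> \<xi> - rep_word \<rho> xs \<xi>) \<le> \<epsilon>" if "\<rho> \<in> reps" for \<rho>
      proof -
        have "integrated_form G D.C_alg (fst \<rho>) (snd \<rho>) F = rep_word \<rho> xs"
          by (rule xs(2)[rule_format, OF reps_D[OF that]])
        with bspec[OF F(2) that] show ?thesis by (simp add: case_prod_beta)
      qed
      then have "\<forall>\<rho>\<in>reps. \<forall>\<xi>. norm (T \<rho> \<xi> - rep_word \<rho> xs \<xi>) \<le> \<epsilon> * norm \<xi>"
        using onorm_iff[OF _ xs(1)] by simp
      with xs(1) show ?R by blast
    next
      assume ?R
      then obtain xs where xs: "xs \<in> D.words"
        "\<And>\<rho>. \<rho> \<in> reps \<Longrightarrow> onorm (\<lambda>\<xi>. T \<rho> \<xi> - rep_word \<rho> xs \<xi>) \<le> \<epsilon>"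
        using onorm_iff by blast
      obtain F where F: "F \<in> fin_supp_funs G D.C_alg"
        "\<forall>\<pi> (u :: 'g \<Rightarrow> 'g univ_space \<Rightarrow> 'g univ_space).
          covariant_pair G N H D \<pi> u \<longrightarrow> integrated_form G D.C_alg \<pi> u F = word_op \<pi> u xs"
        using D.word_as_integrated_form[OF xs(1)] by (elim bexE)
      have "onorm (\<lambda>\<xi>. T \<rho> \<xi> - integrated_form G D.C_alg (fst \<rho>) (snd \<rho>) F \<xi>) \<le> \<epsilon>"
        if "\<rho> \<in> reps" for \<rho>
        unfolding F(2)[rule_format, OF reps_D[OF that]] by (rule xs(2)[OF that])
      then have "\<forall>(\<pi>, u)\<in>reps. onorm (\<lambda>\<xi>. T (\<pi>, u) \<xi> - integrated_form G D.C_alg \<pi> u F \<xi>) \<le> \<epsilon>"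
        by force
      with F(1) show ?L unfolding C_alg_D by (intro bexI[where x = F])
    qed
  qed
  then show ?thesis by (auto simp: crossed_product_def family_def)
qed

lemma CP_family: "T \<in> carrier CP \<Longrightarrow> family T"
  by (simp add: CP_iff)

lemma CP_approx:
  assumes "T \<in> carrier CP" "\<epsilon> > 0"
  obtains xs where "xs \<in> D.words"
    "\<And>\<rho> \<xi>. \<rho> \<in> reps \<Longrightarrow> norm (T \<rho> \<xi> - rep_word \<rho> xs \<xi>) \<le> \<epsilon> * norm \<xi>"
  using assms CP_iff by meson

lemma CP_add:
  assumes "S \<in> carrier CP" "T \<in> carrier CP"
  shows "aadd CP S T \<in> carrier CP"
  unfolding CP_iff CP_simps
proof (intro conjI allI impI)
  show "family (\<lambda>\<rho> \<xi>. S \<rho> \<xi> + T \<rho> \<xi>)"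
    using CP_family[OF assms(1)] CP_family[OF assms(2)]
    by (auto simp: family_def bounded_clinear_add)
  fix \<epsilon> :: real assume "\<epsilon> > 0"
  then have "\<epsilon> / 2 > 0" by simp
  from CP_approx[OF assms(1) this] CP_approx[OF assms(2) this] obtain xs ys
    where xs: "xs \<in> D.words" "\<And>\<rho> \<xi>. \<rho> \<in> reps \<Longrightarrow> norm (S \<rho> \<xi> - rep_word \<rho> xs \<xi>) \<le> \<epsilon> / 2 * norm \<xi>"
      and ys: "ys \<in> D.words" "\<And>\<rho> \<xi>. \<rho> \<in> reps \<Longrightarrow> norm (T \<rho> \<xi> - rep_word \<rho> ys \<xi>) \<le> \<epsilon> / 2 * norm \<xi>"
    by metis
  have "norm (S \<rho> \<xi> + T \<rho> \<xi> - rep_word \<rho> (xs @ ys) \<xi>) \<le> \<epsilon> * norm \<xi>" if "\<rho> \<in> reps" for \<rho> \<xi>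
  proof -
    have "S \<rho> \<xi> + T \<rho> \<xi> - rep_word \<rho> (xs @ ys) \<xi>
        = (S \<rho> \<xi> - rep_word \<rho> xs \<xi>) + (T \<rho> \<xi> - rep_word \<rho> ys \<xi>)"
      by (simp add: word_op_append)
    with norm_triangle_mono[OF xs(2)[OF that] ys(2)[OF that], of \<xi> \<xi>] show ?thesis
      by (simp only: distrib_right[symmetric] field_sum_of_halves)
  qed
  then show "\<exists>xs\<in>D.words. \<forall>\<rho>\<in>reps. \<forall>\<xi>. norm (S \<rho> \<xi> + T \<rho> \<xi> - rep_word \<rho> xs \<xi>) \<le> \<epsilon> * norm \<xi>"
    using xs(1) ys(1) by (intro bexI[of _ "xs @ ys"]) (auto simp: D.words_simps)
qed

text \<open>
  Words have adjoints that are words, hence their norm limits are adjointable and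
  \<open>cadjoint\<close> denotes a genuine adjoint on the crossed product.
\<close>

lemma CP_adjoint:
  assumes "T \<in> carrier CP"
  shows "is_adjoint (T \<rho>) (astar CP T \<rho>)"
proof -
  have "\<exists>S. is_adjoint (T \<rho>) S"
  proof (cases "\<rho> \<in> reps")
    case True
    show ?thesis
    proof (rule adjoint_of_norm_limit)
      show "T \<rho> (\<i> *\<^sub>C x) = \<i> *\<^sub>C T \<rho> x" for x
        by (rule bounded_clinearD(2)[OF familyD[OF CP_family[OF assms]]])
      fix \<epsilon> :: real assume "\<epsilon> > 0"
      then obtain xs where "xs \<in> D.words" "\<And>\<xi>. norm (T \<rho> \<xi> - rep_word \<rho> xs \<xi>) \<le> \<epsilon> * norm \<xi>"
        using CP_approx[OF assms] True by metis
      then show "\<exists>T' S'. is_adjoint T' S' \<and> (\<forall>x. norm (T \<rho> x - T' x) \<le> \<epsilon> * norm x)"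
        using covariant_pair.W_star[OF reps_D[OF True]] by blast
    qed
  next
    case False
    then show ?thesis using CP_family[OF assms] is_adjoint_zero by (auto simp: family_def)
  qed
  then show ?thesis using cadjoint_eq by (fastforce simp: CP_simps)
qed

lemma CP_star:
  assumes "T \<in> carrier CP"
  shows "astar CP T \<in> carrier CP"
  unfolding CP_iff
proof (intro conjI allI impI)
  note T = CP_family[OF assms]
  show "family (astar CP T)"
    unfolding family_def
  proof (intro conjI ballI allI impI)
    fix \<rho>
    show "bounded_clinear (astar CP T \<rho>)"
      by (rule adjoint_bounded_clinear[OF CP_adjoint[OF assms] familyD[OF T]])
    assume "\<rho> \<notin> reps"
    with T have "T \<rho> = (\<lambda>_. 0)" by (simp add: family_def)
    then show "astar CP T \<rho> = (\<lambda>_. 0)" by (simp add: CP_simps cadjoint_eq[OF is_adjoint_zero])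
  qed
  fix \<epsilon> :: real assume "\<epsilon> > 0"
  from CP_approx[OF assms this] obtain xs where xs: "xs \<in> D.words"
    "\<And>\<rho> \<xi>. \<rho> \<in> reps \<Longrightarrow> norm (T \<rho> \<xi> - rep_word \<rho> xs \<xi>) \<le> \<epsilon> * norm \<xi>" by metis
  have "norm (astar CP T \<rho> \<xi> - rep_word \<rho> (D.word_star xs) \<xi>) \<le> \<epsilon> * norm \<xi>" if "\<rho> \<in> reps" for \<rho> \<xi>
    by (rule adjoint_norm_le[OF is_adjoint_diff[OF CP_adjoint[OF assms]
            covariant_pair.W_star[OF reps_D[OF that] xs(1)]] xs(2)[OF that]])
  then show "\<exists>xs\<in>D.words. \<forall>\<rho>\<in>reps. \<forall>\<xi>. norm (astar CP T \<rho> \<xi> - rep_word \<rho> xs \<xi>) \<le> \<epsilon> * norm \<xi>"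
    using D.word_star_in[OF xs(1)] by blast
qed

text \<open>
  Composition of multipliers is composition of restricted maps, so to compute products in
  the multiplier algebra with families it must be known that they map the crossed product into itself.
\<close>

definition multiplies :: "'g univ_family \<Rightarrow> bool"
  where "multiplies t \<longleftrightarrow> family t \<and> (\<forall>a\<in>carrier CP. amult CP t a \<in> carrier CP \<and> amult CP a t \<in> carrier CP)"

text \<open>
  A uniformly bounded family that multiplies words to words multiplies their norm limits into
  the crossed product.
\<close>

lemma multipliesI:
  assumes s: "family s" and K: "\<And>\<rho> \<xi>. \<rho> \<in> reps \<Longrightarrow> norm (s \<rho> \<xi>) \<le> K * norm \<xi>"
    and left: "\<And>xs. xs \<in> D.words \<Longrightarrow>
      \<exists>ys\<in>D.words. \<forall>\<rho>\<in>reps. \<forall>\<xi>. rep_word \<rho> ys \<xi> = s \<rho> (rep_word \<rho> xs \<xi>)"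
    and right: "\<And>xs. xs \<in> D.words \<Longrightarrow>
      \<exists>ys\<in>D.words. \<forall>\<rho>\<in>reps. \<forall>\<xi>. rep_word \<rho> ys \<xi> = rep_word \<rho> xs (s \<rho> \<xi>)"
  shows "multiplies s"
  unfolding multiplies_def
proof (intro conjI ballI s)
  fix T assume T: "T \<in> carrier CP"
  \<comment> \<open>A positive bound, so that \<open>\<epsilon>\<close> may be divided by it.\<close>
  define L where "L = max K 1"
  have "K * norm \<xi> \<le> L * norm \<xi>" for \<xi> :: "'g univ_space"
    by (intro mult_right_mono) (simp_all add: L_def)
  then have L: "L > 0" "\<And>\<rho> \<xi>. \<rho> \<in> reps \<Longrightarrow> norm (s \<rho> \<xi>) \<le> L * norm \<xi>"
    using K order_trans by (simp add: L_def, blast)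
  have approx: "\<exists>xs\<in>D.words. \<forall>\<rho>\<in>reps. \<forall>\<xi>. norm (T \<rho> \<xi> - rep_word \<rho> xs \<xi>) \<le> \<epsilon> / L * norm \<xi>"
    if "\<epsilon> > 0" for \<epsilon>
    using CP_approx[OF T, of "\<epsilon> / L"] that L(1) by (metis divide_pos_pos)
  have zero: "s \<rho> 0 = 0" "T \<rho> 0 = 0" for \<rho>
    by (auto intro!: bounded_clinearD(5) familyD s CP_family T)
  show "amult CP s T \<in> carrier CP"
    unfolding CP_iff CP_simps
  proof (intro conjI allI impI)
    show "family (\<lambda>\<rho> \<xi>. s \<rho> (T \<rho> \<xi>))"
      using s CP_family[OF T] by (auto simp: family_def bounded_clinear_comp)
    fix \<epsilon> :: real assume "\<epsilon> > 0"
    from approx[OF this] obtain xs where xs: "xs \<in> D.words"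
      "\<And>\<rho> \<xi>. \<rho> \<in> reps \<Longrightarrow> norm (T \<rho> \<xi> - rep_word \<rho> xs \<xi>) \<le> \<epsilon> / L * norm \<xi>" by blast
    obtain ys where ys: "ys \<in> D.words"
      "\<And>\<rho> \<xi>. \<rho> \<in> reps \<Longrightarrow> rep_word \<rho> ys \<xi> = s \<rho> (rep_word \<rho> xs \<xi>)"
      using left[OF xs(1)] by blast
    have "norm (s \<rho> (T \<rho> \<xi>) - rep_word \<rho> ys \<xi>) \<le> \<epsilon> * norm \<xi>" if "\<rho> \<in> reps" for \<rho> \<xi>
    proof -
      have "norm (s \<rho> (T \<rho> \<xi>) - rep_word \<rho> ys \<xi>) = norm (s \<rho> (T \<rho> \<xi> - rep_word \<rho> xs \<xi>))"
        by (simp add: ys(2)[OF that] bounded_clinearD(4)[OF familyD[OF s]])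
      also have "\<dots> \<le> L * norm (T \<rho> \<xi> - rep_word \<rho> xs \<xi>)" by (rule L(2)[OF that])
      also have "\<dots> \<le> L * (\<epsilon> / L * norm \<xi>)" using xs(2)[OF that] L(1) by (intro mult_left_mono) auto
      finally show ?thesis using L(1) by simp
    qed
    with ys(1) show "\<exists>xs\<in>D.words. \<forall>\<rho>\<in>reps. \<forall>\<xi>.
        norm (s \<rho> (T \<rho> \<xi>) - rep_word \<rho> xs \<xi>) \<le> \<epsilon> * norm \<xi>" by blast
  qed
  show "amult CP T s \<in> carrier CP"
    unfolding CP_iff CP_simps
  proof (intro conjI allI impI)
    show "family (\<lambda>\<rho> \<xi>. T \<rho> (s \<rho> \<xi>))"
      using s CP_family[OF T] by (auto simp: family_def bounded_clinear_comp)
    fix \<epsilon> :: real assume "\<epsilon> > 0"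
    from approx[OF this] obtain xs where xs: "xs \<in> D.words"
      "\<And>\<rho> \<xi>. \<rho> \<in> reps \<Longrightarrow> norm (T \<rho> \<xi> - rep_word \<rho> xs \<xi>) \<le> \<epsilon> / L * norm \<xi>" by blast
    obtain ys where ys: "ys \<in> D.words"
      "\<And>\<rho> \<xi>. \<rho> \<in> reps \<Longrightarrow> rep_word \<rho> ys \<xi> = rep_word \<rho> xs (s \<rho> \<xi>)"
      using right[OF xs(1)] by blast
    have "norm (T \<rho> (s \<rho> \<xi>) - rep_word \<rho> ys \<xi>) \<le> \<epsilon> * norm \<xi>" if "\<rho> \<in> reps" for \<rho> \<xi>
    proof -
      have "norm (T \<rho> (s \<rho> \<xi>) - rep_word \<rho> ys \<xi>) \<le> \<epsilon> / L * norm (s \<rho> \<xi>)"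
        unfolding ys(2)[OF that] by (rule xs(2)[OF that])
      also have "\<dots> \<le> \<epsilon> / L * (L * norm \<xi>)"
        using L \<open>\<epsilon> > 0\<close> that by (intro mult_left_mono) auto
      finally show ?thesis using L(1) by simp
    qed
    with ys(1) show "\<exists>xs\<in>D.words. \<forall>\<rho>\<in>reps. \<forall>\<xi>.
        norm (T \<rho> (s \<rho> \<xi>) - rep_word \<rho> xs \<xi>) \<le> \<epsilon> * norm \<xi>" by blast
  qed
qed

definition fun_family :: "('g \<Rightarrow> complex) \<Rightarrow> 'g univ_family"
  where "fun_family f = (\<lambda>\<rho>. if \<rho> \<in> reps then fst \<rho> f else (\<lambda>_. 0))"

definition group_family :: "'g \<Rightarrow> 'g univ_family"
  where "group_family g = (\<lambda>\<rho>. if \<rho> \<in> reps then snd \<rho> g else (\<lambda>_. 0))"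

definition word_family :: "('g \<times> ('g \<Rightarrow> complex)) list \<Rightarrow> 'g univ_family"
  where "word_family xs = (\<lambda>\<rho>. if \<rho> \<in> reps then rep_word \<rho> xs else (\<lambda>_. 0))"

text \<open>
  On \<open>D\<^sub>0\<close> a bound that is uniform over all representations is elementary: the generators are
  represented by projections, which have norm at most one.
\<close>

lemma D0_uniform_bound:
  assumes "f \<in> D0"
  shows "\<exists>K. \<forall>\<rho>\<in>reps. \<forall>\<xi>. norm (fst \<rho> f \<xi>) \<le> K * norm \<xi>"
  using assms
proof (induction rule: D0_induct)
  case zero
  show ?case using covariant_pair.pi_zero[OF reps_D0] by (intro exI[of _ 0]) simp
next
  case (coset f)
  have f: "f \<in> D0" using coset by (rule D0_intros)
  have idem: "(\<lambda>y. f y * f y) = f" and star: "(\<lambda>y. cnj (f y)) = f"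
    using coset by (auto simp: coset_funs_def indicator_def)
  have "norm (fst \<rho> f \<xi>) \<le> 1 * norm \<xi>" if "\<rho> \<in> reps" for \<rho> \<xi>
  proof (cases "fst \<rho> f \<xi> = 0")
    case False
    interpret covariant_pair G N H D0 "fst \<rho>" "snd \<rho>" by (rule reps_D0[OF that])
    have "norm (fst \<rho> f \<xi>) * norm (fst \<rho> f \<xi>) = inner (fst \<rho> f \<xi>) (fst \<rho> f \<xi>)"
      by (simp add: dot_square_norm power2_eq_square)
    also have "\<dots> = inner \<xi> (fst \<rho> f (fst \<rho> f \<xi>))"
      using is_adjoint_inner[OF pi_star[OF f], unfolded star] .
    also have "fst \<rho> f (fst \<rho> f \<xi>) = fst \<rho> f \<xi>" using pi_mult[OF f f, of \<xi>] by (simp add: idem)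
    also have "inner \<xi> (fst \<rho> f \<xi>) \<le> norm \<xi> * norm (fst \<rho> f \<xi>)" by (rule norm_cauchy_schwarz)
    finally show ?thesis using False by simp
  qed simp
  then show ?case by blast
next
  case (add f k)
  then obtain K L where "\<And>\<rho> \<xi>. \<rho> \<in> reps \<Longrightarrow> norm (fst \<rho> f \<xi>) \<le> K * norm \<xi>"
    "\<And>\<rho> \<xi>. \<rho> \<in> reps \<Longrightarrow> norm (fst \<rho> k \<xi>) \<le> L * norm \<xi>" by metis
  then have "norm (fst \<rho> (\<lambda>y. f y + k y) \<xi>) \<le> (K + L) * norm \<xi>" if "\<rho> \<in> reps" for \<rho> \<xi>
    using that norm_triangle_mono[of "fst \<rho> f \<xi>" "K * norm \<xi>" "fst \<rho> k \<xi>" "L * norm \<xi>"]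
    by (simp add: covariant_pair.pi_add[OF reps_D0[OF that] add.hyps] distrib_right)
  then show ?case by blast
next
  case (scale f c)
  then obtain K where K: "\<And>\<rho> \<xi>. \<rho> \<in> reps \<Longrightarrow> norm (fst \<rho> f \<xi>) \<le> K * norm \<xi>" by metis
  have "norm (fst \<rho> (\<lambda>y. c * f y) \<xi>) \<le> (cmod c * K) * norm \<xi>" if "\<rho> \<in> reps" for \<rho> \<xi>
    using mult_left_mono[OF K[OF that, of \<xi>], of "cmod c"]
      covariant_pair.pi_scale[OF reps_D0[OF that] scale.hyps]
    by (simp add: norm_scaleC mult.assoc)
  then show ?case by blast
qed

lemma fun_family_multiplies:
  assumes "f \<in> D0"
  shows "multiplies (fun_family f)"
proof -
  obtain K where K: "\<And>\<rho> \<xi>. \<rho> \<in> reps \<Longrightarrow> norm (fst \<rho> f \<xi>) \<le> K * norm \<xi>"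
    using D0_uniform_bound[OF assms] by blast
  have f: "f \<in> D" using assms D0_sub_D by blast
  show ?thesis
  proof (rule multipliesI)
    show "family (fun_family f)"
      using covariant_pair.pi_bounded[OF reps_D f] by (simp add: family_def fun_family_def)
    show "\<rho> \<in> reps \<Longrightarrow> norm (fun_family f \<rho> \<xi>) \<le> K * norm \<xi>" for \<rho> \<xi>
      using K by (simp add: fun_family_def)
    fix xs assume xs: "xs \<in> D.words"
    show "\<exists>ys\<in>D.words. \<forall>\<rho>\<in>reps. \<forall>\<xi>. rep_word \<rho> ys \<xi> = fun_family f \<rho> (rep_word \<rho> xs \<xi>)"
      using covariant_pair.W_lmult_fun[OF reps_D xs f] D.word_lmult_fun_in[OF xs f]
      by (intro bexI[of _ "D.word_lmult_fun f xs"]) (simp_all add: fun_family_def)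
    show "\<exists>ys\<in>D.words. \<forall>\<rho>\<in>reps. \<forall>\<xi>. rep_word \<rho> ys \<xi> = rep_word \<rho> xs (fun_family f \<rho> \<xi>)"
      using covariant_pair.W_rmult_fun[OF reps_D xs f] D.word_rmult_fun_in[OF xs f]
      by (intro bexI[of _ "D.word_rmult_fun f xs"]) (simp_all add: fun_family_def)
  qed
qed

lemma group_family_multiplies:
  assumes g: "g \<in> carrier G"
  shows "multiplies (group_family g)"
proof (rule multipliesI)
  show "family (group_family g)"
    using covariant_pair.u_bounded[OF reps_D g] by (simp add: family_def group_family_def)
  show "\<rho> \<in> reps \<Longrightarrow> norm (group_family g \<rho> \<xi>) \<le> 1 * norm \<xi>" for \<rho> \<xi>
    using covariant_pair.u_norm[OF reps_D g] by (simp add: group_family_def)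
  fix xs assume xs: "xs \<in> D.words"
  show "\<exists>ys\<in>D.words. \<forall>\<rho>\<in>reps. \<forall>\<xi>. rep_word \<rho> ys \<xi> = group_family g \<rho> (rep_word \<rho> xs \<xi>)"
    using covariant_pair.W_lmult_group[OF reps_D xs g] D.word_lmult_group_in[OF xs g]
    by (intro bexI[of _ "D.word_lmult_group g xs"]) (simp_all add: group_family_def)
  show "\<exists>ys\<in>D.words. \<forall>\<rho>\<in>reps. \<forall>\<xi>. rep_word \<rho> ys \<xi> = rep_word \<rho> xs (group_family g \<rho> \<xi>)"
    using covariant_pair.W_rmult_group[OF reps_D xs g] D.word_rmult_group_in[OF xs g]
    by (intro bexI[of _ "D.word_rmult_group g xs"]) (simp_all add: group_family_def)
qed

lemma multiplies_mult:
  assumes "multiplies s" "multiplies t"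
  shows "multiplies (amult CP s t)"
proof -
  have "amult CP (amult CP s t) a = amult CP s (amult CP t a)"
    "amult CP a (amult CP s t) = amult CP (amult CP a s) t" for a
    by (simp_all add: CP_simps)
  moreover have "family (amult CP s t)"
    using assms by (auto simp: multiplies_def family_def CP_simps bounded_clinear_comp)
  ultimately show ?thesis using assms by (simp add: multiplies_def)
qed

lemma CP_distrib:
  assumes "family a"
  shows "amult CP a (aadd CP s t) = aadd CP (amult CP a s) (amult CP a t)"
    "amult CP (aadd CP s t) a = aadd CP (amult CP s a) (amult CP t a)"
    "amult CP a (ascale CP c t) = ascale CP c (amult CP a t)"
    "amult CP (ascale CP c t) a = ascale CP c (amult CP t a)"
  using bounded_clinearD(2,3)[OF familyD[OF assms]] by (simp_all add: CP_simps)

lemma multiplies_add: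
  assumes "multiplies s" "multiplies t"
  shows "multiplies (aadd CP s t)"
proof -
  have "family (aadd CP s t)"
    using assms by (auto simp: multiplies_def family_def CP_simps bounded_clinear_add)
  then show ?thesis
    using assms by (simp add: multiplies_def CP_distrib[OF CP_family] CP_add)
qed

lemma word_family_Nil: "word_family [] = (\<lambda>_ _. 0)"
  by (intro ext) (simp add: word_family_def word_op_Nil)

lemma word_family_Cons:
  "word_family ((g, f) # xs) = aadd CP (amult CP (group_family g) (fun_family f)) (word_family xs)"
  by (intro ext) (simp add: word_family_def group_family_def fun_family_def CP_simps word_op_Cons)

lemma word_family_single: "word_family [(g, f)] = amult CP (group_family g) (fun_family f)"
  by (intro ext) (simp add: word_family_def group_family_def fun_family_def CP_simps word_op_def)

lemma CP_mult_zero: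
  assumes "a \<in> carrier CP"
  shows "amult CP a (\<lambda>_ _. 0) = (\<lambda>_ _. 0)" "amult CP (\<lambda>_ _. 0) a = (\<lambda>_ _. 0)"
  using bounded_clinearD(5)[OF familyD[OF CP_family[OF assms]]] by (simp_all add: CP_simps)

lemma word_family_multiplies: "xs \<in> D0.words \<Longrightarrow> multiplies (word_family xs)"
proof (induction xs)
  case Nil
  have "[] \<in> D.words" by (simp add: D.words_simps)
  then have "(\<lambda>_ _. 0) \<in> carrier CP"
    by (auto simp: CP_iff family_def bounded_clinear_zero word_op_Nil intro!: bexI[of _ "[]"])
  then show ?case
    by (simp add: multiplies_def word_family_Nil CP_mult_zero CP_family)
next
  case (Cons p xs)
  then show ?case
    by (cases p) (simp add: word_family_Cons D0.words_simps multiplies_add multiplies_mult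
        group_family_multiplies fun_family_multiplies)
qed

section \<open>Elements of the algebraic crossed product\<close>

abbreviation "MA \<equiv> multiplier_algebra CP"

lemma mult_by_add: "aadd MA (mult_by CP s) (mult_by CP t) = mult_by CP (aadd CP s t)"
  by (auto simp: mult_by_def multiplier_algebra_simps CP_distrib[OF CP_family] intro!: restrict_ext)

lemma mult_by_scale: "ascale MA c (mult_by CP t) = mult_by CP (ascale CP c t)"
  by (auto simp: mult_by_def multiplier_algebra_simps CP_distrib[OF CP_family] intro!: restrict_ext)

lemma mult_by_mult:
  assumes "multiplies s" "multiplies t"
  shows "amult MA (mult_by CP s) (mult_by CP t) = mult_by CP (amult CP s t)"
  using assms
  by (auto simp: mult_by_def multiplier_algebra_simps compose_def multiplies_def intro!: restrict_ext)
    (simp_all add: CP_simps)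

text \<open>
  The star of a multiplier conjugates it by the star of the crossed product and exchanges the two
  sides, so this is \<open>(a\<^sup>* t)\<^sup>* = t\<^sup>* a\<close> and its mirror image.
\<close>

lemma mult_by_star:
  assumes adj: "\<And>\<rho>. is_adjoint (t \<rho>) (t' \<rho>)"
  shows "astar MA (mult_by CP t) = mult_by CP t'"
proof -
  have "astar CP (amult CP (astar CP a) t) = amult CP t' a"
    "astar CP (amult CP t (astar CP a)) = amult CP a t'" if a: "a \<in> carrier CP" for a
  proof -
    have adj_a: "is_adjoint (astar CP a \<rho>) (a \<rho>)" for \<rho>
      by (rule is_adjoint_sym[OF CP_adjoint[OF a]])
    show "astar CP (amult CP (astar CP a) t) = amult CP t' a"
      unfolding CP_simps(4,5)[of "amult CP (astar CP a) t"]
      using cadjoint_eq[OF is_adjoint_comp[OF adj_a adj]] by (simp add: CP_simps)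
    show "astar CP (amult CP t (astar CP a)) = amult CP a t'"
      using cadjoint_eq[OF is_adjoint_comp[OF adj adj_a]] by (simp add: CP_simps)
  qed
  then show ?thesis
    by (auto simp: mult_by_def multiplier_algebra_simps CP_star intro!: restrict_ext)
qed

definition word_elem :: "('g \<times> ('g \<Rightarrow> complex)) list \<Rightarrow> 'g crossed_multiplier"
  where "word_elem xs = mult_by CP (word_family xs)"

lemma gf_elem_word:
  assumes "g \<in> carrier G" "f \<in> D0"
  shows "gf_elem G N H M g f = word_elem [(g, f)]"
proof -
  have "i_G G N H M g = mult_by CP (group_family g)" "i_D G N H M f = mult_by CP (fun_family f)"
    by (simp_all add: i_G_def i_D_def group_family_def fun_family_def)
  then show ?thesis
    using assms unfolding gf_elem_def word_elem_def word_family_single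
    by (simp add: mult_by_mult group_family_multiplies fun_family_multiplies)
qed

lemma word_elem_append: "aadd MA (word_elem xs) (word_elem ys) = word_elem (xs @ ys)"
proof -
  have "aadd CP (word_family xs) (word_family ys) = word_family (xs @ ys)"
    by (intro ext) (simp add: word_family_def CP_simps word_op_append)
  then show ?thesis by (simp add: word_elem_def mult_by_add)
qed

lemma word_elem_scale:
  assumes "xs \<in> D0.words"
  shows "ascale MA c (word_elem xs) = word_elem (D0.word_scale c xs)"
proof -
  have "ascale CP c (word_family xs) = word_family (D0.word_scale c xs)"
    using covariant_pair.W_scale[OF reps_D0 assms]
    by (intro ext) (simp add: word_family_def CP_simps scaleC_zero_right)
  then show ?thesis by (simp add: word_elem_def mult_by_scale)
qed

lemma word_elem_mult:
  assumes "xs \<in> D0.words" "ys \<in> D0.words"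
  shows "amult MA (word_elem xs) (word_elem ys) = word_elem (D0.word_mult xs ys)"
proof -
  have "amult CP (word_family xs) (word_family ys) = word_family (D0.word_mult xs ys)"
    using covariant_pair.W_mult[OF reps_D0 assms]
    by (intro ext) (simp add: word_family_def CP_simps)
  then show ?thesis
    using assms by (simp add: word_elem_def mult_by_mult word_family_multiplies)
qed

lemma word_elem_star:
  assumes "xs \<in> D0.words"
  shows "astar MA (word_elem xs) = word_elem (D0.word_star xs)"
  unfolding word_elem_def
  using covariant_pair.W_star[OF reps_D0 assms]
  by (intro mult_by_star) (simp add: word_family_def is_adjoint_zero)

lemma azero_word: "azero MA = word_elem []"
  by (auto simp: word_elem_def word_family_Nil mult_by_def multiplier_algebra_simps CP_simps(1)
      CP_mult_zero intro!: restrict_ext)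

abbreviation "ACP \<equiv> algebraic_crossed_product G N H M"

lemma ACP_simps: "aadd ACP = aadd MA" "ascale ACP = ascale MA" "amult ACP = amult MA"
  "astar ACP = astar MA"
  by (simp_all add: algebraic_crossed_product_def)

lemma ACP_carrier: "carrier ACP = word_elem ` D0.words"
proof -
  let ?S = "{gf_elem G N H M g f | g f. g \<in> carrier G \<and> f \<in> D0}"
  have "a \<in> word_elem ` D0.words" if "a \<in> alg_span MA ?S" for a
    using that
  proof (induction rule: alg_span.induct)
    case zero
    show ?case using D0.words_simps(1) by (simp add: azero_word)
  next
    case (base s)
    then show ?case using gf_elem_word D0.words_simps by (fastforce intro!: image_eqI)
  next
    case (add a b)
    then obtain xs ys where "a = word_elem xs" "b = word_elem ys" "xs \<in> D0.words" "ys \<in> D0.words"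
      by auto
    then show ?case by (simp add: word_elem_append D0.words_simps)
  next
    case (scale a c)
    then obtain xs where "a = word_elem xs" "xs \<in> D0.words" by auto
    then show ?case by (simp add: word_elem_scale D0.word_scale_in)
  qed
  moreover have "word_elem xs \<in> alg_span MA ?S" if "xs \<in> D0.words" for xs
    using that
  proof (induction xs)
    case Nil
    show ?case using alg_span.zero[of MA] by (simp add: azero_word)
  next
    case (Cons p xs)
    obtain g f where p: "p = (g, f)" by fastforce
    with Cons have in': "g \<in> carrier G" "f \<in> D0" "xs \<in> D0.words" by (auto simp: D0.words_simps)
    then have "word_elem (p # xs) = aadd MA (gf_elem G N H M g f) (word_elem xs)"
      by (simp add: gf_elem_word word_elem_append p)
    moreover have "gf_elem G N H M g f \<in> alg_span MA ?S" using in' by (intro alg_span.base) blast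
    ultimately show ?case using Cons in' by (simp add: alg_span.add)
  qed
  ultimately show ?thesis by (auto simp: algebraic_crossed_product_def)
qed

section \<open>Existence and uniqueness of the integrated form\<close>

lemma M_conjugate: "M \<in> conjugates G H M"
proof -
  have "(\<lambda>m. \<one> \<otimes> m \<otimes> inv \<one>) ` M = id ` M"
    using M_sub_N N_carrier by (intro image_cong) auto
  then show ?thesis using H_closed(3) unfolding conjugates_eq by force
qed

text \<open>As an integrated form, \<open>f\<close> is the word \<open>\<one> f\<close>.\<close>

lemma fun_family_in_CP:
  assumes "f \<in> D0"
  shows "fun_family f \<in> carrier CP"
proof -
  have f: "f \<in> D" using assms D0_sub_D by blast
  have "rep_word \<rho> [(\<one>, f)] \<xi> = fun_family f \<rho> \<xi>" if "\<rho> \<in> reps" for \<rho> \<xi>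
    using that covariant_pair.u_one[OF reps_D[OF that]] by (simp add: word_op_def fun_family_def)
  then show ?thesis
    using f fun_family_multiplies[OF assms]
    by (auto simp: CP_iff multiplies_def D.words_simps intro!: bexI[of _ "[(\<one>, f)]"])
qed

text \<open>
  The regular representation reads off all coefficients.  A multiplier is known only through its
  action on the crossed product, so the family is first multiplied by the indicator of \<open>y M\<close>, an
  element of the crossed product that fixes the basis vector at \<open>y\<close>.
\<close>

lemma word_elem_determines_coeff:
  assumes xs: "xs \<in> D0.words" and ys: "ys \<in> D0.words" and eq: "word_elem xs = word_elem ys"
    and g: "g \<in> carrier G"
  shows "D0.coeff xs g = D0.coeff ys g"
proof
  fix y
  show "D0.coeff xs g y = D0.coeff ys g y"
  proof (cases "y \<in> N")
    case True
    define k :: "'g \<Rightarrow> complex" where "k = indicator (y <# M)"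
    have k: "k \<in> D0"
      using True M_conjugate by (intro D0_intros(1)) (auto simp: k_def coset_funs_def)
    have y: "y \<in> carrier G" "npart G N H y = y" "k y = 1"
    proof -
      show "y \<in> carrier G" "npart G N H y = y" using True by (simp_all add: N_carrier npart_N)
      then have "y \<in> y <# M"
        using subgroup.one_closed[OF M_subgroup] by (force simp: l_coset_def)
      then show "k y = 1" by (simp add: k_def)
    qed
    let ?\<rho> = "(regular_fun, regular_group)" and ?e = "ell2_basis (y, 0) :: 'g univ_space"
    have fix_e: "regular_fun k ?e = ?e"
    proof (rule ell2_eqI, clarify)
      fix h n
      show "ell2_coord (regular_fun k ?e) (h, n) = ell2_coord ?e (h, n)"
        by (cases "h \<in> carrier G")
          (auto simp: regular_fun_coord[OF D0.C_bounded[OF k]] ell2_basis_coord y)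
    qed
    have apply_k: "fst (word_elem zs) (fun_family k) = amult CP (word_family zs) (fun_family k)" for zs
      using fun_family_in_CP[OF k] by (simp add: word_elem_def mult_by_def)
    have "amult CP (word_family xs) (fun_family k) = amult CP (word_family ys) (fun_family k)"
      using eq by (simp flip: apply_k)
    then have "amult CP (word_family xs) (fun_family k) ?\<rho> ?e = amult CP (word_family ys) (fun_family k) ?\<rho> ?e"
      by simp
    then have "word_op regular_fun regular_group xs ?e = word_op regular_fun regular_group ys ?e"
      by (simp add: CP_simps word_family_def fun_family_def regular_in_reps fix_e)
    then show ?thesis
      using D0.regular_word_coord[OF xs g y(1)] D0.regular_word_coord[OF ys g y(1)] y(2) by simp
  next
    case False
    then show ?thesis using D0.C_outside[OF D0.coeff_in] xs ys by simp
  qed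
qed

text \<open>
  \<open>word_op \<pi> u\<close> depends on a word only through its coefficients, and these are determined by the
  element that the word represents.
\<close>

lemma word_op_well_defined:
  assumes "covariant_pair G N H D0 \<pi> u"
    and xs: "xs \<in> D0.words" and ys: "ys \<in> D0.words" and eq: "word_elem xs = word_elem ys"
  shows "word_op \<pi> u xs = word_op \<pi> u ys"
proof
  fix \<xi>
  interpret covariant_pair G N H D0 \<pi> u by (rule assms(1))
  let ?S = "fst ` set xs \<union> fst ` set ys"
  have S: "?S \<subseteq> carrier G" using xs ys by (auto simp: D0.words_def)
  have "word_op \<pi> u xs \<xi> = (\<Sum>g\<in>?S. u g (\<pi> (D0.coeff xs g) \<xi>))"
    using xs S by (intro W_coeff) auto
  also have "\<dots> = (\<Sum>g\<in>?S. u g (\<pi> (D0.coeff ys g) \<xi>))"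
    using word_elem_determines_coeff[OF xs ys eq] S by (intro sum.cong) auto
  also have "\<dots> = word_op \<pi> u ys \<xi>"
    using ys S by (intro W_coeff[symmetric]) auto
  finally show "word_op \<pi> u xs \<xi> = word_op \<pi> u ys \<xi>" .
qed

lemma representation_determined:
  assumes "representation ACP \<Psi>"
    and gf: "\<And>g f. g \<in> carrier G \<Longrightarrow> f \<in> D0 \<Longrightarrow> \<Psi> (gf_elem G N H M g f) = u g \<circ> \<pi> f"
    and "xs \<in> D0.words"
  shows "\<Psi> (word_elem xs) = word_op \<pi> u xs"
  using assms(3)
proof (induction xs)
  case Nil
  have "ascale MA 0 (word_elem []) = word_elem []"
    using Nil by (simp add: word_elem_scale D0.word_scale_def)
  moreover have "\<Psi> (ascale MA 0 (word_elem [])) = (\<lambda>\<xi>. 0 *\<^sub>C \<Psi> (word_elem []) \<xi>)"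
    using assms(1) Nil by (simp add: representation_def ACP_simps ACP_carrier)
  ultimately show ?case by (simp add: word_op_Nil scaleC_zero_left)
next
  case (Cons p xs)
  obtain g f where p: "p = (g, f)" by fastforce
  with Cons have in': "g \<in> carrier G" "f \<in> D0" "xs \<in> D0.words" by (auto simp: D0.words_simps)
  have "word_elem (p # xs) = aadd MA (word_elem [(g, f)]) (word_elem xs)"
    by (simp add: word_elem_append p)
  also have "\<Psi> \<dots> = (\<lambda>\<xi>. \<Psi> (word_elem [(g, f)]) \<xi> + \<Psi> (word_elem xs) \<xi>)"
    using assms(1) in' by (simp add: representation_def ACP_simps ACP_carrier D0.words_simps)
  also have "\<Psi> (word_elem [(g, f)]) = u g \<circ> \<pi> f"
    using gf in' by (simp flip: gf_elem_word)
  finally show ?case using Cons.IH in' by (simp add: p word_op_Cons)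
qed

lemma integrated_form_exists_unique:
  fixes \<pi> :: "('g \<Rightarrow> complex) \<Rightarrow> 'x \<Rightarrow> 'x::complex_hilbert"
  assumes "covariant_representation G N H (D0_alg G N H M) \<pi> u"
  shows "\<exists>!\<Phi>. \<Phi> \<in> extensional (carrier ACP) \<and> representation ACP \<Phi> \<and>
    (\<forall>g\<in>carrier G. \<forall>f\<in>D0. \<Phi> (gf_elem G N H M g f) = u g \<circ> \<pi> f)"
proof (rule ex_ex1I)
  have pair: "covariant_pair G N H D0 \<pi> u" by (rule covariant_pair_D0I[OF assms])
  then interpret covariant_pair G N H D0 \<pi> u .
  \<comment> \<open>The word representing an element is not unique; the choice does not matter by
    \<open>word_op_well_defined\<close>.\<close>
  define \<Phi> where "\<Phi> = (\<lambda>m\<in>carrier ACP. word_op \<pi> u (SOME xs. xs \<in> D0.words \<and> m = word_elem xs))"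
  have \<Phi>: "\<Phi> (word_elem xs) = word_op \<pi> u xs" if xs: "xs \<in> D0.words" for xs
  proof -
    let ?ys = "SOME ys. ys \<in> D0.words \<and> word_elem xs = word_elem ys"
    have "?ys \<in> D0.words \<and> word_elem xs = word_elem ?ys" by (rule someI[of _ xs]) (simp add: xs)
    then have "word_op \<pi> u ?ys = word_op \<pi> u xs"
      using word_op_well_defined[OF pair xs, of ?ys] by simp
    moreover have "\<Phi> (word_elem xs) = word_op \<pi> u ?ys"
      unfolding \<Phi>_def using xs by (intro restrict_apply') (simp add: ACP_carrier)
    ultimately show ?thesis by simp
  qed
  have "representation ACP \<Phi>"
    unfolding representation_def ACP_simps
  proof (intro conjI ballI allI)
    fix a assume "a \<in> carrier ACP"
    then obtain xs where xs: "xs \<in> D0.words" "a = word_elem xs" by (auto simp: ACP_carrier)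
    show "bounded_clinear (\<Phi> a)" using xs by (simp add: \<Phi> W_bounded)
    show "\<Phi> (ascale MA c a) = (\<lambda>\<xi>. c *\<^sub>C \<Phi> a \<xi>)" for c
      using xs by (auto simp: word_elem_scale \<Phi> D0.word_scale_in W_scale)
    show "is_adjoint (\<Phi> a) (\<Phi> (astar MA a))"
      using xs by (simp add: word_elem_star \<Phi> D0.word_star_in W_star)
    fix b assume "b \<in> carrier ACP"
    then obtain ys where ys: "ys \<in> D0.words" "b = word_elem ys" by (auto simp: ACP_carrier)
    show "\<Phi> (aadd MA a b) = (\<lambda>\<xi>. \<Phi> a \<xi> + \<Phi> b \<xi>)"
      using xs ys by (simp add: word_elem_append \<Phi> D0.words_simps word_op_append)
    show "\<Phi> (amult MA a b) = \<Phi> a \<circ> \<Phi> b"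
      using xs ys by (auto simp: word_elem_mult \<Phi> D0.word_mult_in W_mult)
  qed
  moreover have "\<Phi> (gf_elem G N H M g f) = u g \<circ> \<pi> f" if "g \<in> carrier G" "f \<in> D0" for g f
    using that by (auto simp: gf_elem_word \<Phi> D0.words_simps word_op_def)
  moreover have "\<Phi> \<in> extensional (carrier ACP)" by (simp add: \<Phi>_def)
  ultimately show "\<exists>\<Phi>. \<Phi> \<in> extensional (carrier ACP) \<and> representation ACP \<Phi> \<and>
      (\<forall>g\<in>carrier G. \<forall>f\<in>D0. \<Phi> (gf_elem G N H M g f) = u g \<circ> \<pi> f)" by (intro exI[of _ \<Phi>] conjI ballI)
next
  fix \<Phi> \<Psi>
  assume \<Phi>: "\<Phi> \<in> extensional (carrier ACP) \<and> representation ACP \<Phi> \<and>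
      (\<forall>g\<in>carrier G. \<forall>f\<in>D0. \<Phi> (gf_elem G N H M g f) = u g \<circ> \<pi> f)"
    and \<Psi>: "\<Psi> \<in> extensional (carrier ACP) \<and> representation ACP \<Psi> \<and>
      (\<forall>g\<in>carrier G. \<forall>f\<in>D0. \<Psi> (gf_elem G N H M g f) = u g \<circ> \<pi> f)"
  show "\<Phi> = \<Psi>"
  proof (rule extensionalityI)
    show "\<Phi> \<in> extensional (carrier ACP)" "\<Psi> \<in> extensional (carrier ACP)" using \<Phi> \<Psi> by simp_all
    fix a assume "a \<in> carrier ACP"
    then obtain xs where "xs \<in> D0.words" "a = word_elem xs" by (auto simp: ACP_carrier)
    then show "\<Phi> a = \<Psi> a"
      using representation_determined[of \<Phi> u \<pi> xs] representation_determined[of \<Psi> u \<pi> xs] \<Phi> \<Psi> by simp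
  qed
qed

end

theorem corollary4p5:
  fixes G :: "('g, 'm) monoid_scheme" and N H M :: "'g set"
    and \<pi> :: "('g \<Rightarrow> complex) \<Rightarrow> 'x \<Rightarrow> 'x::complex_hilbert" and u :: "'g \<Rightarrow> 'x \<Rightarrow> 'x"
  assumes "semidirect_product G N H"
    and "M \<lhd> G\<lparr>carrier := N\<rparr>" and "M \<noteq> {\<one>\<^bsub>G\<^esub>}"
    and "is_filter_base (conjugates G H M)"
    and "separating G (conjugates G H M)"
    and "has_finite_quotients G (conjugates G H M)"
    and "acts_effectively G H M"
    and "covariant_representation G N H (D0_alg G N H M) \<pi> u"
  shows "\<exists>!\<Phi> :: 'g crossed_multiplier \<Rightarrow> 'x \<Rightarrow> 'x.
    \<Phi> \<in> extensional (carrier (algebraic_crossed_product G N H M)) \<and>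
    representation (algebraic_crossed_product G N H M) \<Phi> \<and>
    (\<forall>g\<in>carrier G. \<forall>f\<in>carrier (D0_alg G N H M). \<Phi> (gf_elem G N H M g f) = u g \<circ> \<pi> f)"
proof -
  interpret normal_conjugates G N H M
    using assms
    by (intro normal_conjugates.intro semidirect.intro normal_conjugates_axioms.intro)
  show ?thesis by (rule integrated_form_exists_unique[OF assms(8)])
qed

end
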